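(* For any fixed integer $k\ge0$ and any fixed finite nonempty alphabet $\Sigma$, the consistency problem for functions of 1-head rank at most $k$ over the alphabet $\Sigma$ is solvable in polynomial time.
   Context: **Rank.** Let $f\colon\Sigma^n\to\{0,1\}$. An assignment is a pair $(i,\sigma)$ with $i\in\{1,\ldots,n\}$, $\sigma\in\Sigma$; $A$ is the set of all assignments. The assignment $(i,\sigma)$ is consistent with $\bar w=(\sigma_1,\ldots,\sigma_n)\in\Sigma^n$ iff $\sigma_i=\sigma$. For a bijection $\tau\colon\{1,\ldots,|A|\}\to A$ (a permutation of $A$), the a-query $q_\tau\colon\Sigma^n\to A$ is defined by $q_\tau(\bar w)=\tau(j)$ for the minimal $j$ such that $\tau(j)$ is consistent with $\bar w$. A decision tree over a-queries is a rooted tree in which each non-leaf node $v$ is labeled by an a-query $q_v$ and has exactly $|\mathrm{Im}(q_v)|$ outgoing edges, labeled by the distinct elements of $\mathrm{Im}(q_v)$, and each leaf is labeled by an element of $\{0,1\}$; on input $\bar w$ one descends from the root, at each $v$ following the edge labeled $q_v(\bar w)$, and outputs the label of the leaf reached. The tree computes $f$ if it outputs $f(\bar w)$ on every $\bar w$. The depth is the maximal number of edges on a root-to-leaf path. The 1-head rank $\mathrm{rk}(f)=\mathrm{rk}^{(1)}(f)$ is the minimal depth of a decision tree over a-queries computing $f$. **Consistency problem.** For functions of 1-head rank at most $k$ over $\Sigma$, the hypothesis class for $n$ is $H_n=\{f\colon\Sigma^n\to\{0,1\}\mid\mathrm{rk}^{(1)}(f)\le k\}$. The input is a number $n$ and a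 sample $(x_1,y_1),\ldots,(x_m,y_m)\in\Sigma^n\times\{0,1\}$. The task is to decide whether there exists $h\in H_n$ with $h(x_1)=y_1,\ldots,h(x_m)=y_m$, and to find such an $h$ if it exists. An element $h\in H_n$ is represented by a decision tree over a-queries of depth at most $k$ computing it (each a-query being given by its permutation of assignments). Polynomial time means polynomial in $n$ and $m$, with $k$ and $\Sigma$ fixed. *)

theory Defs
  imports Main
begin

section \<open>Words, assignments, a-queries\<close>

text \<open>
  The alphabet is the (finite, nonempty) type \<open>'a\<close>; labels \<open>0, 1\<close> are \<^const>\<open>False\<close>, \<^const>\<open>True\<close>.
  A function on words of length \<open>n\<close> is a function on lists of which only the values on
  \<open>words n\<close> are ever used.
\<close>

type_synonym 'a assignment = "nat \<times> 'a"

definition words :: "nat \<Rightarrow> 'a list set" where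
  "words n = {w. length w = n}"

definition assignments :: "nat \<Rightarrow> 'a assignment set" where
  "assignments n = {1..n} \<times> UNIV"

text \<open>Positions are counted from 1, list indices from 0.\<close>

definition consistent :: "'a assignment \<Rightarrow> 'a list \<Rightarrow> bool" where
  "consistent a w \<longleftrightarrow> w ! (fst a - 1) = snd a"

text \<open>A permutation of the assignments is given by the list of its values.\<close>

definition is_permutation :: "nat \<Rightarrow> 'a assignment list \<Rightarrow> bool" where
  "is_permutation n \<tau> \<longleftrightarrow> distinct \<tau> \<and> set \<tau> = assignments n"

definition aquery :: "'a assignment list \<Rightarrow> 'a list \<Rightarrow> 'a assignment" where
  "aquery \<tau> w = \<tau> ! (LEAST j. j < length \<tau> \<and> consistent (\<tau> ! j) w)"


section \<open>Decision trees over a-queries and the 1-head rank\<close>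

text \<open>
  An inner node carries the permutation of its a-query and the list of its outgoing edges,
  each an edge label together with the subtree below it.
\<close>

datatype 'a dtree =
    Leaf bool
  | Node "'a assignment list" "('a assignment \<times> 'a dtree) list"

text \<open>
  The condition \<open>0 < n\<close> only matters for \<open>n = 0\<close>: then there are no assignments, hence no map from
  the one-element set \<open>words 0\<close> to assignments, and all trees are leaves.
\<close>

fun wf_dtree :: "nat \<Rightarrow> 'a dtree \<Rightarrow> bool" where
  "wf_dtree n (Leaf b) \<longleftrightarrow> True"
| "wf_dtree n (Node \<tau> es) \<longleftrightarrow>
     0 < n \<and> is_permutation n \<tau> \<and>
     distinct (map fst es) \<and> set (map fst es) = aquery \<tau> ` words n \<and>
     (\<forall>(a, t) \<in> set es. wf_dtree n t)"

fun outcome :: "'a dtree \<Rightarrow> 'a list \<Rightarrow> bool" where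
  "outcome (Leaf b) w = b"
| "outcome (Node \<tau> es) w =
     the (map_of (map (\<lambda>(a, t). (a, outcome t w)) es) (aquery \<tau> w))"

fun depth :: "'a dtree \<Rightarrow> nat" where
  "depth (Leaf b) = 0"
| "depth (Node \<tau> es) = Suc (Max (insert 0 (set (map (\<lambda>(a, t). depth t) es))))"

definition computes :: "nat \<Rightarrow> 'a dtree \<Rightarrow> ('a list \<Rightarrow> bool) \<Rightarrow> bool" where
  "computes n t f \<longleftrightarrow> wf_dtree n t \<and> (\<forall>w \<in> words n. outcome t w = f w)"

definition rk :: "nat \<Rightarrow> ('a list \<Rightarrow> bool) \<Rightarrow> nat" where
  "rk n f = (LEAST d. \<exists>t. computes n t f \<and> depth t = d)"


section \<open>The consistency problem\<close>

definition hyp_class :: "nat \<Rightarrow> nat \<Rightarrow> ('a list \<Rightarrow> bool) set" where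
  "hyp_class k n = {f. rk n f \<le> k}"

type_synonym 'a sample = "('a list \<times> bool) list"

definition instances :: "(nat \<times> 'a sample) set" where
  "instances = {(n, S). \<forall>(x, y) \<in> set S. x \<in> words n}"

definition fits :: "('a list \<Rightarrow> bool) \<Rightarrow> 'a sample \<Rightarrow> bool" where
  "fits h S \<longleftrightarrow> (\<forall>(x, y) \<in> set S. h x = y)"

definition represents :: "nat \<Rightarrow> nat \<Rightarrow> 'a dtree \<Rightarrow> ('a list \<Rightarrow> bool) \<Rightarrow> bool" where
  "represents k n t h \<longleftrightarrow> computes n t h \<and> depth t \<le> k"

definition correct_answer :: "nat \<Rightarrow> nat \<times> 'a sample \<Rightarrow> 'a dtree option \<Rightarrow> bool" where
  "correct_answer k = (\<lambda>(n, S) ans. case ans of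
       None \<Rightarrow> \<not> (\<exists>h \<in> hyp_class k n. fits h S)
     | Some t \<Rightarrow> (\<exists>h \<in> hyp_class k n. fits h S \<and> represents k n t h))"


section \<open>Polynomial time\<close>

text \<open>
  The machine model is a first-order call-by-value functional language over binary trees, with
  mutually recursive functions, in the style of N. D. Jones, \<^emph>\<open>Computability and Complexity from
  a Programming Perspective\<close> (1997).  Its only primitives are the empty tree, pairing, the two
  projections and the test for the empty tree; there is no arithmetic.  The running time is the
  number of evaluation steps.  With values kept as pointers to shared, immutable cells, a step
  takes a bounded number of elementary pointer operations and allocates at most one cell, so that
  a run of length \<open>t\<close> can be simulated by a Turing machine in time polynomial in \<open>t\<close> and the size
  of the input; conversely a Turing machine is simulated with constant overhead per step.
  Sharing may however compress a result, so the size of the written-out result is bounded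
  separately below; with this bound the model defines polynomial-time computability in the
  usual sense.
\<close>

datatype data = Null | Cell data data

primrec dfst :: "data \<Rightarrow> data" where
  "dfst Null = Null"
| "dfst (Cell u v) = u"

primrec dsnd :: "data \<Rightarrow> data" where
  "dsnd Null = Null"
| "dsnd (Cell u v) = v"

primrec cells :: "data \<Rightarrow> nat" where
  "cells Null = 1"
| "cells (Cell u v) = Suc (cells u + cells v)"

text \<open>
  Variables are de Bruijn indices into the list of current values.  \<open>EIf\<close> takes its first branch
  iff the condition is not \<open>Null\<close>.  A program is the list of the bodies of its functions; \<open>ECall f\<close>
  calls the \<open>f\<close>-th one, whose body sees exactly the argument values.
\<close>

datatype expr =
    EVar nat
  | ENull
  | ECell expr expr
  | EFst expr
  | ESnd expr
  | EIf expr expr expr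
  | ELet expr expr
  | ECall nat "expr list"

type_synonym program = "expr list"

text \<open>\<open>eval P \<rho> e v t\<close>: in environment \<open>\<rho>\<close> the expression \<open>e\<close> evaluates to \<open>v\<close> in \<open>t\<close> steps.\<close>

inductive
  eval :: "program \<Rightarrow> data list \<Rightarrow> expr \<Rightarrow> data \<Rightarrow> nat \<Rightarrow> bool" and
  evals :: "program \<Rightarrow> data list \<Rightarrow> expr list \<Rightarrow> data list \<Rightarrow> nat \<Rightarrow> bool"
  for P :: program
where
  EVar: "i < length \<rho> \<Longrightarrow> eval P \<rho> (EVar i) (\<rho> ! i) 1"
| ENull: "eval P \<rho> ENull Null 1"
| ECell: "eval P \<rho> e1 v1 t1 \<Longrightarrow> eval P \<rho> e2 v2 t2 \<Longrightarrow>
    eval P \<rho> (ECell e1 e2) (Cell v1 v2) (t1 + t2 + 1)"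
| EFst: "eval P \<rho> e v t \<Longrightarrow> eval P \<rho> (EFst e) (dfst v) (t + 1)"
| ESnd: "eval P \<rho> e v t \<Longrightarrow> eval P \<rho> (ESnd e) (dsnd v) (t + 1)"
| EIf_Cell: "eval P \<rho> e v1 t1 \<Longrightarrow> v1 \<noteq> Null \<Longrightarrow> eval P \<rho> e1 v t2 \<Longrightarrow>
    eval P \<rho> (EIf e e1 e2) v (t1 + t2 + 1)"
| EIf_Null: "eval P \<rho> e v1 t1 \<Longrightarrow> v1 = Null \<Longrightarrow> eval P \<rho> e2 v t2 \<Longrightarrow>
    eval P \<rho> (EIf e e1 e2) v (t1 + t2 + 1)"
| ELet: "eval P \<rho> e1 v1 t1 \<Longrightarrow> eval P (v1 # \<rho>) e2 v t2 \<Longrightarrow>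
    eval P \<rho> (ELet e1 e2) v (t1 + t2 + 1)"
| ECall: "f < length P \<Longrightarrow> evals P \<rho> es vs t1 \<Longrightarrow> eval P vs (P ! f) v t2 \<Longrightarrow>
    eval P \<rho> (ECall f es) v (t1 + t2 + 1)"
| EvalsNil: "evals P \<rho> [] [] 0"
| EvalsCons: "eval P \<rho> e v t1 \<Longrightarrow> evals P \<rho> es vs t2 \<Longrightarrow>
    evals P \<rho> (e # es) (v # vs) (t1 + t2)"

inductive_cases EVar_elim: "eval P \<rho> (EVar i) v t"
inductive_cases ENull_elim: "eval P \<rho> ENull v t"
inductive_cases ECell_elim: "eval P \<rho> (ECell e1 e2) v t"
inductive_cases EFst_elim: "eval P \<rho> (EFst e) v t"
inductive_cases ESnd_elim: "eval P \<rho> (ESnd e) v t"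
inductive_cases EIf_elim: "eval P \<rho> (EIf e e1 e2) v t"
inductive_cases ELet_elim: "eval P \<rho> (ELet e1 e2) v t"
inductive_cases ECall_elim: "eval P \<rho> (ECall f es) v t"
inductive_cases EvalsNil_elim: "evals P \<rho> [] vs t"
inductive_cases EvalsCons_elim: "evals P \<rho> (e # es) vs t"

lemma eval_deterministic:
  "eval P \<rho> e v t \<Longrightarrow> eval P \<rho> e v' t' \<Longrightarrow> v = v' \<and> t = t'"
  "evals P \<rho> es vs s \<Longrightarrow> evals P \<rho> es vs' s' \<Longrightarrow> vs = vs' \<and> s = s'"
proof (induction arbitrary: v' t' and vs' s' rule: eval_evals.inducts)
  case (EVar i \<rho>)
  from EVar.prems show ?case by (rule EVar_elim) simp
next
  case (ENull \<rho>)
  from ENull.prems show ?case by (rule ENull_elim) simp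
next
  case (ECell \<rho> e1 v1 t1 e2 v2 t2)
  from ECell.prems show ?case by (rule ECell_elim) (auto dest!: ECell.IH(2,4))
next
  case (EFst \<rho> e v t)
  from EFst.prems show ?case by (rule EFst_elim) (auto dest!: EFst.IH(2))
next
  case (ESnd \<rho> e v t)
  from ESnd.prems show ?case by (rule ESnd_elim) (auto dest!: ESnd.IH(2))
next
  case (EIf_Cell \<rho> e v1 t1 e1 v t2 e2)
  from EIf_Cell.prems
    show ?case by (rule EIf_elim) (auto dest!: EIf_Cell.IH(2,4) simp: EIf_Cell.hyps)+
next
  case (EIf_Null \<rho> e v1 t1 e2 v t2 e1)
  from EIf_Null.prems
    show ?case by (rule EIf_elim) (auto dest!: EIf_Null.IH(2,4) simp: EIf_Null.hyps)+
next
  case (ELet \<rho> e1 v1 t1 e2 v t2)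
  from ELet.prems show ?case by (rule ELet_elim) (auto dest!: ELet.IH(2,4))
next
  case (ECall f \<rho> es vs t1 v t2)
  from ECall.prems show ?case by (rule ECall_elim) (auto dest!: ECall.IH(3,5))
next
  case (EvalsNil \<rho>)
  from EvalsNil.prems show ?case by (rule EvalsNil_elim) simp
next
  case (EvalsCons \<rho> e v t1 es vs t2)
  from EvalsCons.prems show ?case by (rule EvalsCons_elim) (auto dest!: EvalsCons.IH(2,4))
qed

text \<open>The first function of a program is its entry point.\<close>

definition runs :: "program \<Rightarrow> data \<Rightarrow> data \<Rightarrow> nat \<Rightarrow> bool" where
  "runs P inp out t \<longleftrightarrow> eval P [inp] (ECall 0 [EVar 0]) out t"

text \<open>
  \<open>poly_time_solvable I enc_in sz enc_out correct\<close>: a single program computes, for every instance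
  \<open>x\<close> in \<open>I\<close>, a correct answer, within time and output size polynomial in \<open>sz x\<close>.
\<close>

definition poly_time_solvable ::
  "'i set \<Rightarrow> ('i \<Rightarrow> data) \<Rightarrow> ('i \<Rightarrow> nat) \<Rightarrow> ('o \<Rightarrow> data) \<Rightarrow> ('i \<Rightarrow> 'o \<Rightarrow> bool) \<Rightarrow> bool" where
  "poly_time_solvable I enc_in sz enc_out correct \<longleftrightarrow>
     (\<exists>P C d. \<forall>x \<in> I. \<exists>y t.
        runs P (enc_in x) (enc_out y) t \<and> correct x y \<and>
        t \<le> C * (sz x + 1) ^ d \<and> cells (enc_out y) \<le> C * (sz x + 1) ^ d)"


section \<open>Encodings\<close>

text \<open>
  Numbers are written in unary; since the time bound is in terms of the number \<open>n\<close> itself, this is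
  no loss.  The parameter \<open>c\<close> is an arbitrary numbering of the letters of the alphabet.
\<close>

primrec enc_nat :: "nat \<Rightarrow> data" where
  "enc_nat 0 = Null"
| "enc_nat (Suc n) = Cell Null (enc_nat n)"

definition enc_bool :: "bool \<Rightarrow> data" where
  "enc_bool b = (if b then Cell Null Null else Null)"

fun enc_list :: "data list \<Rightarrow> data" where
  "enc_list [] = Null"
| "enc_list (v # vs) = Cell v (enc_list vs)"

definition enc_word :: "('a \<Rightarrow> nat) \<Rightarrow> 'a list \<Rightarrow> data" where
  "enc_word c w = enc_list (map (\<lambda>\<sigma>. enc_nat (c \<sigma>)) w)"

definition enc_instance :: "('a \<Rightarrow> nat) \<Rightarrow> nat \<times> 'a sample \<Rightarrow> data" where
  "enc_instance c = (\<lambda>(n, S). Cell (enc_nat n)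
     (enc_list (map (\<lambda>(x, y). Cell (enc_word c x) (enc_bool y)) S)))"

definition enc_assignment :: "('a \<Rightarrow> nat) \<Rightarrow> 'a assignment \<Rightarrow> data" where
  "enc_assignment c = (\<lambda>(i, \<sigma>). Cell (enc_nat i) (enc_nat (c \<sigma>)))"

fun enc_dtree :: "('a \<Rightarrow> nat) \<Rightarrow> 'a dtree \<Rightarrow> data" where
  "enc_dtree c (Leaf b) = Cell Null (enc_bool b)"
| "enc_dtree c (Node \<tau> es) = Cell (Cell Null Null)
     (Cell (enc_list (map (enc_assignment c) \<tau>))
           (enc_list (map (\<lambda>(a, t). Cell (enc_assignment c a) (enc_dtree c t)) es)))"

fun enc_answer :: "('a \<Rightarrow> nat) \<Rightarrow> 'a dtree option \<Rightarrow> data" where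
  "enc_answer c None = Null"
| "enc_answer c (Some t) = Cell Null (enc_dtree c t)"

text \<open>The encodings lose no information.\<close>

lemma enc_nat_inject [simp]: "enc_nat m = enc_nat n \<longleftrightarrow> m = n"
proof (induction m arbitrary: n)
  case 0
  then show ?case by (cases n) auto
next
  case (Suc m)
  then show ?case by (cases n) auto
qed

lemma enc_bool_inject [simp]: "enc_bool a = enc_bool b \<longleftrightarrow> a = b"
  by (simp add: enc_bool_def)

lemma enc_list_inject [simp]: "enc_list us = enc_list vs \<longleftrightarrow> us = vs"
proof (induction us arbitrary: vs)
  case Nil
  then show ?case by (cases vs) auto
next
  case (Cons u us)
  then show ?case by (cases vs) auto
qed

lemma enc_word_inject: "inj c \<Longrightarrow> enc_word c v = enc_word c w \<longleftrightarrow> v = w"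
  by (auto simp: enc_word_def inj_def intro!: map_injective injI)

lemma enc_assignment_inject: "inj c \<Longrightarrow> enc_assignment c a = enc_assignment c b \<longleftrightarrow> a = b"
  by (cases a; cases b) (auto simp: enc_assignment_def inj_eq)

lemma inj_enc_instance:
  assumes "inj c"
  shows "inj (enc_instance c)"
proof -
  have "inj (\<lambda>(x, y). Cell (enc_word c x) (enc_bool y))"
    by (rule injI) (auto simp: enc_word_inject[OF assms])
  then show ?thesis
    by (auto simp: enc_instance_def intro!: injI dest: map_injective)
qed

lemma enc_dtree_inject:
  assumes "inj c"
  shows "enc_dtree c s = enc_dtree c t \<Longrightarrow> s = t"
proof (induction s arbitrary: t)
  case (Leaf b)
  then show ?case by (cases t) auto
next
  case (Node \<tau> es)
  obtain \<tau>' es' where t: "t = Node \<tau>' es'"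
    using Node.prems by (cases t) auto
  have "inj (enc_assignment c)"
    by (rule injI) (simp add: enc_assignment_inject[OF assms])
  then have "\<tau> = \<tau>'"
    using Node.prems t by (auto dest: map_injective)
  moreover have "es = es'"
  proof (rule list.inj_map_strong)
    show "map (\<lambda>(a, t). Cell (enc_assignment c a) (enc_dtree c t)) es =
      map (\<lambda>(a, t). Cell (enc_assignment c a) (enc_dtree c t)) es'"
      using Node.prems t by simp
  next
    fix x y
    assume x: "x \<in> set es" and "y \<in> set es'" and
      eq: "(\<lambda>(a, t). Cell (enc_assignment c a) (enc_dtree c t)) x =
        (\<lambda>(a, t). Cell (enc_assignment c a) (enc_dtree c t)) y"
    obtain a s b u where xy: "x = (a, s)" "y = (b, u)"
      by (cases x; cases y)
    have "a = b"
      using eq xy by (simp add: enc_assignment_inject[OF assms])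
    moreover have "s = u"
      using eq xy x by (intro Node.IH[of x s u]) auto
    ultimately show "x = y"
      using xy by simp
  qed
  ultimately show ?case
    using t by simp
qed

lemma inj_enc_answer:
  assumes "inj c"
  shows "inj (enc_answer c)"
proof (rule injI)
  fix r s
  assume "enc_answer c r = enc_answer c s"
  then show "r = s"
    by (cases r; cases s) (auto dest: enc_dtree_inject[OF assms])
qed

end

theory Submission
  imports Defs
begin

text \<open>
  A tree of positive depth is a decision list over assignments whose leaves are trees of smaller
  depth, so Rivest's greedy learner for decision lists applies recursively: among the assignments
  not yet used, pick any one such that the remaining examples consistent with it are fitted by a
  tree of depth \<open>k - 1\<close>, and discard these examples.  Discarding examples only makes the problem
  easier, so an arbitrary choice is safe.  Each level makes at most \<open>|A|\<^sup>2\<close> recursive calls, where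
  \<open>A\<close> is the set of all assignments, hence the running time is polynomial for fixed \<open>k\<close>.
\<close>

section \<open>The image of an a-query\<close>

text \<open>Two parts of the definitions shape the details. A node carries a permutation of all
  assignments, yet its edges must be labelled by exactly the image of its query. So
  \<open>greedy\<close> continues until every assignment has a subtree, even when no examples
  remain, and \<open>prune\<close> then deletes the edges that no word can take; the test behind it
  must be cheap, since the words of length \<open>n\<close> may be exponentially many. The rank is a
  \<open>LEAST\<close>, so the answer \<open>None\<close> can be justified only after showing that
  every function has some tree. The machine functions return exactly the encodings of values of HOL
  functions, so the algorithm is verified without the machine. Time is measured in one number
  \<open>X\<close> that bounds the word length, the number of assignments, the letter codes and the
  sample length; for fixed \<open>k\<close> the mutual recursion unfolds into nested bounds, each
  polynomial in \<open>X\<close>.\<close>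

lemma aquery_Cons:
  assumes "\<exists>b \<in> set (a # \<tau>). consistent b w"
  shows "aquery (a # \<tau>) w = (if consistent a w then a else aquery \<tau> w)"
proof (cases "consistent a w")
  case True
  then have "(LEAST j. j < length (a # \<tau>) \<and> consistent ((a # \<tau>) ! j) w) = 0"
    by (intro Least_equality) auto
  then show ?thesis
    unfolding aquery_def using True by simp
next
  case False
  then obtain b where "b \<in> set \<tau>" "consistent b w"
    using assms by auto
  then obtain j where "j < length \<tau>" "consistent (\<tau> ! j) w"
    by (metis in_set_conv_nth)
  \<comment> \<open>Index 0 does not qualify, so the minimum is the successor of the one for the
    tail; \<open>Least_Suc\<close> asks for some qualifying index, here
    \<open>Suc j\<close>.\<close>
  then have "(LEAST j. j < length (a # \<tau>) \<and> consistent ((a # \<tau>) ! j) w) =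
      Suc (LEAST j. Suc j < length (a # \<tau>) \<and> consistent ((a # \<tau>) ! Suc j) w)"
    by (intro Least_Suc[where n = "Suc j"]) (use False in auto)
  then show ?thesis
    unfolding aquery_def using False by simp
qed

lemma aquery_append:
  assumes "\<forall>b \<in> set ps. \<not> consistent b w" "consistent a w"
  shows "aquery (ps @ a # qs) w = a"
  using assms by (induction ps) (auto simp: aquery_Cons)

text \<open>From here on this form replaces the \<open>LEAST\<close> in \<open>aquery\<close>: a
  split at the first consistent entry can be matched with other splits of the same list.\<close>

lemma aquery_split:
  assumes "\<exists>b \<in> set \<tau>. consistent b w"
  obtains ps a qs where "\<tau> = ps @ a # qs" "\<forall>b \<in> set ps. \<not> consistent b w" "consistent a w"
    "aquery \<tau> w = a"
proof -
  obtain ps a qs where "\<tau> = ps @ a # qs" "consistent a w" "\<forall>b \<in> set ps. \<not> consistent b w"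
    using split_list_first_prop[OF assms] by metis
  then show ?thesis
    using that aquery_append by blast
qed

text \<open>Position 1 exists because \<open>0 < n\<close>, and its letter gives a consistent
  assignment, which a permutation must list. Hence the minimum in \<open>aquery\<close> is
  attained.\<close>

lemma permutation_consistent:
  assumes "0 < n" "is_permutation n \<tau>" "w \<in> words n"
  shows "\<exists>b \<in> set \<tau>. consistent b w"
  by (rule bexI[of _ "(1, w ! 0)"])
    (use assms in \<open>auto simp: is_permutation_def assignments_def consistent_def\<close>)

text \<open>Says that some word can be spelled with assignments from \<open>B\<close>. In this form
  it is checked position by position instead of by a search over words.\<close>

definition covering :: "nat \<Rightarrow> 'a assignment set \<Rightarrow> bool" where
  "covering n B \<longleftrightarrow> {1..n} \<subseteq> fst ` B"

lemma covering_mono: "covering n B \<Longrightarrow> B \<subseteq> C \<Longrightarrow> covering n C"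
  unfolding covering_def by blast

text \<open>
  A word that avoids a set of assignments exists iff no position has all its assignments in the
  set; hence the image of an a-query is a prefix of its permutation.
\<close>

lemma aquery_image_iff:
  assumes "0 < n" "is_permutation n (ps @ a # qs)"
  shows "a \<in> aquery (ps @ a # qs) ` words n \<longleftrightarrow> covering n (set (a # qs))"
proof
  have set: "set (ps @ a # qs) = assignments n" and dist: "distinct (ps @ a # qs)"
    using assms(2) by (simp_all only: is_permutation_def)
  {
    assume "a \<in> aquery (ps @ a # qs) ` words n"
    then obtain w where w: "w \<in> words n" "aquery (ps @ a # qs) w = a"
      by (metis imageE)
    obtain ps' b qs' where split: "ps @ a # qs = ps' @ b # qs'" "\<forall>b \<in> set ps'. \<not> consistent b w"
      "consistent b w" "aquery (ps @ a # qs) w = b"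
      using aquery_split[OF permutation_consistent[OF assms w(1)]] by blast
    then have "b = a"
      using w by simp
    moreover have "a \<notin> set ps" "a \<notin> set qs"
      using dist by simp_all
    ultimately have "ps' = ps"
      using split(1) append_Cons_eq_iff by metis
    show "covering n (set (a # qs))"
      unfolding covering_def
    proof
      fix i assume i: "i \<in> {1..n}"
      \<comment> \<open>The letter of \<open>w\<close> at \<open>i\<close> is a consistent
        assignment, so it cannot lie in \<open>ps\<close>, whose members are all inconsistent with
        \<open>w\<close>.\<close>
      then have "(i, w ! (i - 1)) \<in> set (ps @ a # qs)"
        unfolding set by (simp add: assignments_def)
      moreover have "(i, w ! (i - 1)) \<notin> set ps"
        using split(2) \<open>ps' = ps\<close> by (auto simp: consistent_def)
      ultimately show "i \<in> fst ` set (a # qs)"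
        by force
    qed
  next
    assume cov: "covering n (set (a # qs))"
    \<comment> \<open>The word takes the letter of \<open>a\<close> at the position of
      \<open>a\<close>, which makes \<open>a\<close> consistent, and any letter remaining in
      \<open>a # qs\<close> elsewhere. By distinctness no entry of \<open>ps\<close> is then
      consistent.\<close>
    define g where "g i = (if i = fst a then snd a else (SOME s. (i, s) \<in> set (a # qs)))" for i
    have g: "(i, g i) \<in> set (a # qs)" if "i \<in> {1..n}" for i
    proof (cases "i = fst a")
      case False
      have "\<exists>s. (i, s) \<in> set (a # qs)"
        using subsetD[OF cov[unfolded covering_def] that] by (metis imageE prod.collapse)
      then have "(i, SOME s. (i, s) \<in> set (a # qs)) \<in> set (a # qs)"
        by (rule someI_ex)
      then show ?thesis
        using False by (simp add: g_def)
    qed (simp add: g_def)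
    define w where "w = map (\<lambda>i. g (Suc i)) [0..<n]"
    have cons: "consistent b w \<longleftrightarrow> b = (fst b, g (fst b))" if "b \<in> assignments n" for b
      using that by (cases b) (auto simp: assignments_def consistent_def w_def)
    have "consistent a w"
      using cons[of a] set by (auto simp: g_def)
    moreover have "\<forall>b \<in> set ps. \<not> consistent b w"
    proof
      fix b assume b: "b \<in> set ps"
      then have bn: "b \<in> assignments n"
        using set by auto
      then have "(fst b, g (fst b)) \<in> set (a # qs)"
        by (intro g) (auto simp: assignments_def)
      then have "b \<noteq> (fst b, g (fst b))"
        using b dist by auto
      then show "\<not> consistent b w"
        using cons[OF bn] by simp
    qed
    ultimately have "aquery (ps @ a # qs) w = a"
      by (simp add: aquery_append)
    moreover have "w \<in> words n"
      by (simp add: words_def w_def)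
    ultimately show "a \<in> aquery (ps @ a # qs) ` words n"
      by (metis imageI)
  }
qed


section \<open>Nodes from decision lists of subtrees\<close>

text \<open>Once a suffix fails to cover, all shorter ones fail too, so stopping at the first
  failure keeps exactly the entries whose suffix covers all positions.\<close>

primrec prune :: "nat \<Rightarrow> ('a assignment \<times> 't) list \<Rightarrow> ('a assignment \<times> 't) list" where
  "prune n [] = []"
| "prune n (p # G) = (if covering n (set (map fst (p # G))) then p # prune n G else [])"

lemma prune_prefix: "\<exists>H. G = prune n G @ H"
  by (induction G) auto

lemma set_prune:
  "p \<in> set (prune n G) \<longleftrightarrow> (\<exists>us vs. G = us @ p # vs \<and> covering n (set (map fst (p # vs))))"
proof (induction G)
  case (Cons q G)
  show ?case
  proof (cases "covering n (set (map fst (q # G)))")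
    case True
    have "p \<in> set (prune n (q # G)) \<longleftrightarrow> p = q \<or> p \<in> set (prune n G)"
      using True by simp
    also have "\<dots> \<longleftrightarrow> (\<exists>us vs. q # G = us @ p # vs \<and> covering n (set (map fst (p # vs))))"
      unfolding Cons.IH using True by (auto simp: Cons_eq_append_conv)
    finally show ?thesis .
  next
    case False
    have "\<not> covering n (set (map fst (p # vs)))" if "q # G = us @ p # vs" for us vs
    proof
      assume "covering n (set (map fst (p # vs)))"
      then have "covering n (set (map fst (q # G)))"
        by (rule covering_mono) (auto simp: that)
      then show False using False by simp
    qed
    then show ?thesis
      using False by (auto simp del: list.map)
  qed
qed simp

definition node :: "nat \<Rightarrow> ('a assignment \<times> 'a dtree) list \<Rightarrow> 'a dtree" where
  "node n G = Node (map fst G) (prune n G)"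

lemma fst_prune:
  assumes "0 < n" "is_permutation n (map fst G)"
  shows "fst ` set (prune n G) = aquery (map fst G) ` words n"
proof (rule set_eqI)
  fix a
  show "a \<in> fst ` set (prune n G) \<longleftrightarrow> a \<in> aquery (map fst G) ` words n"
  proof
    assume "a \<in> fst ` set (prune n G)"
    then obtain p us vs where p: "a = fst p" "G = us @ p # vs" "covering n (set (map fst (p # vs)))"
      by (auto simp: set_prune)
    then show "a \<in> aquery (map fst G) ` words n"
      using aquery_image_iff[of n "map fst us" "fst p" "map fst vs"] assms by simp
  next
    assume a: "a \<in> aquery (map fst G) ` words n"
    then obtain w where w: "w \<in> words n" "aquery (map fst G) w = a"
      by auto
    obtain ps b qs where split: "map fst G = ps @ b # qs" "aquery (map fst G) w = b"
      using aquery_split[OF permutation_consistent[OF assms w(1)]] by metis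
    then have ba: "b = a"
      using w by simp
    obtain us p vs where G: "G = us @ p # vs" "ps = map fst us" "a = fst p" "qs = map fst vs"
      using split(1) unfolding ba by (auto simp: map_eq_append_conv map_eq_Cons_conv)
    have "covering n (set (a # qs))"
      using aquery_image_iff[of n ps a qs] assms a split(1) ba by simp
    then show "a \<in> fst ` set (prune n G)"
      using G by (force simp: set_prune)
  qed
qed

lemma outcome_Node:
  assumes "map_of es (aquery \<tau> w) = Some t"
  shows "outcome (Node \<tau> es) w = outcome t w"
proof -
  have "map_of (map (\<lambda>(a, t). (a, outcome t w)) es) = map_option (\<lambda>t. outcome t w) \<circ> map_of es"
    by (rule map_of_map)
  then show ?thesis
    using assms by simp
qed

context
  fixes n :: nat and G :: "('a assignment \<times> 'a dtree) list"
  assumes n: "0 < n" and perm: "is_permutation n (map fst G)"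
begin

lemma prune_subset: "set (prune n G) \<subseteq> set G"
  using prune_prefix[of G n] by (metis Un_upper1 set_append)

lemma wf_node:
  assumes "\<forall>(a, t) \<in> set G. wf_dtree n t"
  shows "wf_dtree n (node n G)"
proof -
  have "distinct (map fst (prune n G))"
    using prune_prefix[of G n] perm unfolding is_permutation_def
    by (metis distinct_append map_append)
  then show ?thesis
    using n perm assms prune_subset fst_prune[OF n perm] unfolding node_def by auto
qed

lemma outcome_node:
  assumes "w \<in> words n" "(a, t) \<in> set G" "aquery (map fst G) w = a"
  shows "outcome (node n G) w = outcome t w"
proof -
  have dist: "distinct (map fst G)"
    using perm by (simp add: is_permutation_def)
  have "a \<in> fst ` set (prune n G)"
    using fst_prune[OF n perm] assms by auto
  then obtain s where s: "(a, s) \<in> set (prune n G)"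
    by auto
  then have "(a, s) \<in> set G"
    using prune_subset by auto
  then have "s = t"
    using dist assms(2) by (metis map_of_is_SomeI option.inject)
  moreover have "distinct (map fst (prune n G))"
    using dist prune_prefix[of G n] by (metis distinct_append map_append)
  ultimately have "map_of (prune n G) (aquery (map fst G) w) = Some t"
    using s assms(3) by simp
  then show ?thesis
    unfolding node_def by (rule outcome_Node)
qed

end

lemma depth_Node_le:
  assumes "\<forall>(a, t) \<in> set es. depth t \<le> k"
  shows "depth (Node \<tau> es) \<le> Suc k"
  using assms by auto

lemma depth_child:
  assumes "(a, t) \<in> set es"
  shows "depth t < depth (Node \<tau> es)"
proof -
  have "depth t \<le> Max (insert 0 (set (map (\<lambda>(a, t). depth t) es)))"
    using assms by (intro Max_ge) (auto intro!: rev_image_eqI)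
  then show ?thesis by simp
qed

section \<open>Every function has a tree, so the rank is an attained minimum\<close>

lemma finite_words: "finite (words n :: 'a::finite list set)"
  unfolding words_def using finite_lists_length_eq[of "UNIV :: 'a set"] by simp

lemma finite_assignments: "finite (assignments n :: 'a::finite assignment set)"
  unfolding assignments_def by simp

text \<open>The induction step asks for the letter at a position where two words of the sample differ.\<close>

lemma tree_exists_on:
  fixes f :: "'a::finite list \<Rightarrow> bool"
  assumes "W \<subseteq> words n"
  shows "\<exists>t. wf_dtree n t \<and> (\<forall>w \<in> W. outcome t w = f w)"
proof -
  have "finite W"
    using assms finite_words by (rule finite_subset)
  then show ?thesis
    using assms
  proof (induction W rule: finite_psubset_induct)
    case (psubset W)
    show ?case
    proof (cases "\<exists>u \<in> W. \<exists>v \<in> W. u \<noteq> v")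
      case False
      show ?thesis
      proof (cases "W = {}")
        case True
        then show ?thesis by (intro exI[of _ "Leaf True"]) simp
      next
        case ne: False
        then obtain u where "u \<in> W" by blast
        then have "\<forall>w \<in> W. outcome (Leaf (f u)) w = f w"
          using False by auto
        then show ?thesis by (intro exI[of _ "Leaf (f u)"]) simp
      qed
    next
      case True
      then obtain u v where uv: "u \<in> W" "v \<in> W" "u \<noteq> v" by blast
      then have "length u = n" "length v = n"
        using psubset.prems by (auto simp: words_def)
      then obtain p where p: "p < n" "u ! p \<noteq> v ! p"
        using uv by (auto simp: list_eq_iff_nth_eq)
      \<comment> \<open>All assignments of the position where \<open>u\<close> and \<open>v\<close>
        differ, counted from 1. Each word of \<open>W\<close> is consistent with one of them, so
        listing them first in \<open>\<tau>\<close> makes the query read off that letter.\<close>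
      define B where "B = {Suc p} \<times> (UNIV :: 'a set)"
      obtain bs where bs: "set bs = B" "distinct bs"
        using finite_distinct_list[of B] by (auto simp: B_def)
      obtain cs where cs: "set cs = assignments n - B" "distinct cs"
        using finite_distinct_list[of "assignments n - B"] finite_assignments by blast
      define \<tau> where "\<tau> = bs @ cs"
      have "B \<subseteq> assignments n"
        using p by (auto simp: B_def assignments_def)
      then have \<tau>: "is_permutation n \<tau>"
        using bs cs by (auto simp: is_permutation_def \<tau>_def)
      have n: "0 < n" using p by simp
      have query: "aquery \<tau> w = (Suc p, w ! p)" if "w \<in> W" for w
      proof -
        have "w \<in> words n" using that psubset.prems by blast
        obtain ps a qs where split: "\<tau> = ps @ a # qs" "\<forall>b \<in> set ps. \<not> consistent b w"
          "consistent a w" "aquery \<tau> w = a"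
          using aquery_split[OF permutation_consistent[OF n \<tau> \<open>w \<in> words n\<close>]] by metis
        have "(Suc p, w ! p) \<in> set bs"
          using bs by (simp add: B_def)
        moreover have "consistent (Suc p, w ! p) w"
          by (simp add: consistent_def)
        ultimately have "a \<in> set bs"
          using split(1,2) unfolding \<tau>_def by (auto simp: append_eq_append_conv2 append_eq_Cons_conv)
        then obtain s where "a = (Suc p, s)"
          using bs by (auto simp: B_def)
        then show ?thesis
          using split(3,4) by (simp add: consistent_def)
      qed
      have "\<exists>t. wf_dtree n t \<and> (\<forall>w \<in> {w \<in> W. aquery \<tau> w = a}. outcome t w = f w)" for a
      proof (rule psubset.IH)
        show "{w \<in> W. aquery \<tau> w = a} \<subset> W"
        proof (rule psubsetI)
          \<comment> \<open>As \<open>u\<close> and \<open>v\<close> get different answers, no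
            answer class is all of \<open>W\<close>.\<close>
          have "aquery \<tau> u \<noteq> aquery \<tau> v"
            using query uv p by simp
          then have "u \<notin> {w \<in> W. aquery \<tau> w = a} \<or> v \<notin> {w \<in> W. aquery \<tau> w = a}"
            by auto
          then show "{w \<in> W. aquery \<tau> w = a} \<noteq> W"
            using uv(1,2) by metis
        qed blast
        show "{w \<in> W. aquery \<tau> w = a} \<subseteq> words n"
          using psubset.prems by blast
      qed
      then obtain g where g: "\<And>a. wf_dtree n (g a)"
        "\<And>a w. w \<in> W \<Longrightarrow> aquery \<tau> w = a \<Longrightarrow> outcome (g a) w = f w"
        by simp metis
      define G where "G = map (\<lambda>a. (a, g a)) \<tau>"
      have G: "map fst G = \<tau>"
        unfolding G_def by (simp add: comp_def)
      have perm: "is_permutation n (map fst G)"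
        using \<tau> G by simp
      have "outcome (node n G) w = f w" if w: "w \<in> W" for w
      proof -
        have wn: "w \<in> words n" using w psubset.prems by blast
        have "aquery \<tau> w \<in> set \<tau>"
          using aquery_split[OF permutation_consistent[OF n \<tau> wn]]
          by (metis in_set_conv_decomp)
        then have "(aquery \<tau> w, g (aquery \<tau> w)) \<in> set G"
          by (simp add: G_def)
        from outcome_node[OF n perm wn this] show ?thesis
          using G g(2)[OF w] by simp
      qed
      moreover have "wf_dtree n (node n G)"
        by (rule wf_node[OF n perm]) (auto simp: G_def g)
      ultimately show ?thesis by blast
    qed
  qed
qed

text \<open>A \<open>LEAST\<close> over an empty set has no known value. Applying
  \<open>tree_exists_on\<close> to all of \<open>words n\<close> excludes this case, and membership
  in the class becomes existence of a tree.\<close>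

lemma rk_le_iff:
  fixes f :: "'a::finite list \<Rightarrow> bool"
  shows "rk n f \<le> k \<longleftrightarrow> (\<exists>t. computes n t f \<and> depth t \<le> k)"
proof
  obtain t where "computes n t f"
    using tree_exists_on[of "words n" n f] by (auto simp: computes_def)
  then have "\<exists>t. computes n t f \<and> depth t = rk n f"
    unfolding rk_def by (intro LeastI_ex[of "\<lambda>d. \<exists>t. computes n t f \<and> depth t = d"]) blast
  then show "rk n f \<le> k \<Longrightarrow> \<exists>t. computes n t f \<and> depth t \<le> k"
    by auto
next
  assume "\<exists>t. computes n t f \<and> depth t \<le> k"
  then obtain t where t: "computes n t f" "depth t \<le> k" by blast
  then have "rk n f \<le> depth t"
    unfolding rk_def by (intro Least_le) blast
  then show "rk n f \<le> k" using t by simp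
qed


section \<open>The greedy learner\<close>

definition restrict_to :: "'a assignment \<Rightarrow> 'a sample \<Rightarrow> 'a sample" where
  "restrict_to a S = filter (\<lambda>(x, y). consistent a x) S"

definition restrict_off :: "'a assignment \<Rightarrow> 'a sample \<Rightarrow> 'a sample" where
  "restrict_off a S = filter (\<lambda>(x, y). \<not> consistent a x) S"

text \<open>The learner \<open>L\<close> for the level below is a parameter: its properties enter
  the lemmas as hypotheses, and \<open>learn\<close> stays primitive recursive in the rank.\<close>

primrec select :: "('a sample \<Rightarrow> 'a dtree option) \<Rightarrow> 'a sample \<Rightarrow> 'a assignment list \<Rightarrow>
    (('a assignment \<times> 'a dtree) \<times> 'a assignment list) option" where
  "select L S [] = None"
| "select L S (a # R) = (case L (restrict_to a S) of
      Some t \<Rightarrow> Some ((a, t), R)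
    | None \<Rightarrow> map_option (\<lambda>(p, R'). (p, a # R')) (select L S R))"

text \<open>The number counts the rounds, because \<open>select\<close> removes an entry from inside
  the list. It is started at \<open>length R\<close>, so that the keys found exhaust
  \<open>R\<close>.\<close>

primrec greedy :: "('a sample \<Rightarrow> 'a dtree option) \<Rightarrow> nat \<Rightarrow> 'a sample \<Rightarrow> 'a assignment list \<Rightarrow>
    ('a assignment \<times> 'a dtree) list option" where
  "greedy L 0 S R = Some []"
| "greedy L (Suc m) S R = (case select L S R of
      None \<Rightarrow> None
    | Some (p, R') \<Rightarrow> map_option (Cons p) (greedy L m (restrict_off (fst p) S) R'))"

definition labelled :: "bool \<Rightarrow> 'a sample \<Rightarrow> bool" where
  "labelled b S \<longleftrightarrow> (\<forall>p \<in> set S. snd p = b)"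

text \<open>An empty sample counts as labelled \<open>True\<close>, so an edge that no remaining
  example takes gets a leaf at every level.\<close>

definition leaf_or :: "'a dtree option \<Rightarrow> 'a sample \<Rightarrow> 'a dtree option" where
  "leaf_or r S = (if labelled True S then Some (Leaf True)
    else if labelled False S then Some (Leaf False) else r)"

text \<open>For \<open>n = 0\<close> no inner node is well formed, so only leaves are tried.\<close>

primrec learn :: "nat \<Rightarrow> 'a assignment list \<Rightarrow> nat \<Rightarrow> 'a sample \<Rightarrow> 'a dtree option" where
  "learn n A 0 S = leaf_or None S"
| "learn n A (Suc k) S = leaf_or
    (if n = 0 then None else map_option (node n) (greedy (learn n A k) (length A) S A)) S"

section \<open>Soundness of the greedy learner\<close>

lemma select_None: "select L S R = None \<longleftrightarrow> (\<forall>a \<in> set R. L (restrict_to a S) = None)"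
  by (induction R) (auto split: option.splits)

lemma select_Some:
  assumes "select L S R = Some ((a, t), R')"
  shows "L (restrict_to a S) = Some t \<and> (\<exists>us vs. R = us @ a # vs \<and> R' = us @ vs)"
  using assms
proof (induction R arbitrary: R')
  case (Cons b R)
  show ?case
  proof (cases "L (restrict_to b S)")
    case None
    then obtain R'' where R'': "select L S R = Some ((a, t), R'')" "R' = b # R''"
      using Cons.prems by auto
    from Cons.IH[OF this(1)] obtain us vs where
      "L (restrict_to a S) = Some t" "R = us @ a # vs" "R'' = us @ vs" by blast
    then show ?thesis
      using R''(2) by (metis append_Cons)
  next
    case (Some s)
    then have "b = a" "s = t" "R' = R"
      using Cons.prems by simp_all
    then show ?thesis
      using Some by (metis append_Nil)
  qed
qed simp

definition sample_on :: "nat \<Rightarrow> 'a sample \<Rightarrow> bool" where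
  "sample_on n S \<longleftrightarrow> (\<forall>p \<in> set S. fst p \<in> words n)"

lemma sample_on_restrict [simp]:
  "sample_on n S \<Longrightarrow> sample_on n (restrict_to a S)"
  "sample_on n S \<Longrightarrow> sample_on n (restrict_off a S)"
  by (auto simp: sample_on_def restrict_to_def restrict_off_def)

lemma length_restrict:
  "length (restrict_to a S) \<le> length S" "length (restrict_off a S) \<le> length S"
  by (simp_all add: restrict_to_def restrict_off_def)

definition good_tree :: "nat \<Rightarrow> nat \<Rightarrow> 'a sample \<Rightarrow> 'a dtree \<Rightarrow> bool" where
  "good_tree n k S t \<longleftrightarrow> wf_dtree n t \<and> depth t \<le> k \<and> fits (outcome t) S"

text \<open>An example is judged at its first consistent key, expressed by splits of
  \<open>G\<close> so that it fits \<open>aquery_split\<close>. That the keys exhaust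
  \<open>R\<close> without repetition later also bounds the length of \<open>G\<close>.\<close>

lemma greedy_sound:
  assumes L: "\<And>S t. sample_on n S \<Longrightarrow> L S = Some t \<Longrightarrow> good_tree n k S t"
    and "sample_on n S" "greedy L (length R) S R = Some G" "distinct R"
  shows "distinct (map fst G) \<and> set (map fst G) = set R \<and>
    (\<forall>(a, t) \<in> set G. wf_dtree n t \<and> depth t \<le> k) \<and>
    (\<forall>(x, y) \<in> set S. \<forall>us a t vs. G = us @ (a, t) # vs \<longrightarrow>
      (\<forall>b \<in> set (map fst us). \<not> consistent b x) \<longrightarrow> consistent a x \<longrightarrow> outcome t x = y)"
  using assms(2-4)
proof (induction "length R" arbitrary: R S G)
  case 0
  then show ?case by simp
next
  case (Suc m)
  obtain a t R' H where sel: "select L S R = Some ((a, t), R')"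
    and H: "greedy L m (restrict_off a S) R' = Some H" and G: "G = (a, t) # H"
    using Suc.prems(2) Suc.hyps(2)[symmetric] by (auto split: option.splits)
  from select_Some[OF sel] obtain us vs where t: "L (restrict_to a S) = Some t"
    and R: "R = us @ a # vs" "R' = us @ vs" by blast
  have good: "good_tree n k (restrict_to a S) t"
    using L[OF _ t] Suc.prems(1) by simp
  have "m = length R'" "distinct R'"
    using R Suc.hyps(2) Suc.prems(3) by auto
  note IH = Suc.hyps(1)[OF this(1) sample_on_restrict(2)[OF Suc.prems(1)] H[unfolded this(1)] this(2)]
  \<comment> \<open>If the first key is consistent with \<open>x\<close>, the example was among
    those that \<open>t\<close> fits; otherwise it survives in \<open>restrict_off a S\<close>,
    where the induction hypothesis applies.\<close>
  have "outcome s x = y" if xy: "(x, y) \<in> set S" and G': "G = us @ (b, s) # vs"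
    and us: "\<forall>b \<in> set (map fst us). \<not> consistent b x" and b: "consistent b x" for x y us b s vs
  proof (cases us)
    case Nil
    then have "b = a" "s = t"
      using G G' by auto
    then have "(x, y) \<in> set (restrict_to a S)"
      using xy b by (auto simp: restrict_to_def)
    then show ?thesis
      using good \<open>s = t\<close> by (auto simp: good_tree_def fits_def)
  next
    case (Cons p us')
    then have "H = us' @ (b, s) # vs" "p = (a, t)"
      using G G' by auto
    moreover have "(x, y) \<in> set (restrict_off a S)"
      using xy us Cons \<open>p = (a, t)\<close> by (auto simp: restrict_off_def)
    moreover have "\<forall>b \<in> set (map fst us'). \<not> consistent b x"
      using us Cons by auto
    ultimately show ?thesis
      using IH b by blast
  qed
  moreover have "distinct (map fst G)" "set (map fst G) = set R"
    using IH R Suc.prems(3) unfolding G by auto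
  moreover have "\<forall>(a, t) \<in> set G. wf_dtree n t \<and> depth t \<le> k"
    using IH good unfolding G good_tree_def by auto
  ultimately show ?case by auto
qed

lemma leaf_or_sound:
  assumes "leaf_or r S = Some t" "r = Some t \<Longrightarrow> good_tree n k S t"
  shows "good_tree n k S t"
  using assms by (auto simp: leaf_or_def labelled_def good_tree_def fits_def split: if_splits)

lemma learn_sound:
  assumes "is_permutation n A" "sample_on n S" "learn n A k S = Some t"
  shows "good_tree n k S t"
  using assms(2,3)
proof (induction k arbitrary: S t)
  case 0
  then show ?case by (auto intro: leaf_or_sound)
next
  case (Suc k)
  from Suc.prems(2)[unfolded learn.simps] show ?case
  proof (rule leaf_or_sound)
    assume "(if n = 0 then None else
      map_option (node n) (greedy (learn n A k) (length A) S A)) = Some t"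
    then obtain G where n: "0 < n" and G: "greedy (learn n A k) (length A) S A = Some G"
      and t: "t = node n G"
      by (auto split: if_splits)
    have "distinct A"
      using assms(1) by (simp add: is_permutation_def)
    note * = greedy_sound[of n "learn n A k" k, OF Suc.IH Suc.prems(1) G this]
    have perm: "is_permutation n (map fst G)"
      using * assms(1) by (simp add: is_permutation_def)
    have "wf_dtree n t"
      unfolding t using * by (intro wf_node[OF n perm]) auto
    moreover have "depth t \<le> Suc k"
      unfolding t node_def using prune_subset[OF n perm] * by (intro depth_Node_le) auto
    moreover have "outcome t x = y" if xy: "(x, y) \<in> set S" for x y
    proof -
      have x: "x \<in> words n"
        using xy Suc.prems(1) by (auto simp: sample_on_def)
      \<comment> \<open>The first consistent key is both the answer of the query at
        \<open>node n G\<close> and the key at which \<open>greedy_sound\<close> vouches for the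
        subtree.\<close>
      obtain ps a qs where split: "map fst G = ps @ a # qs" "\<forall>b \<in> set ps. \<not> consistent b x"
        "consistent a x" "aquery (map fst G) x = a"
        using aquery_split[OF permutation_consistent[OF n perm x]] by metis
      obtain us s vs where G': "G = us @ (a, s) # vs" "ps = map fst us"
        using split(1) by (auto simp: map_eq_append_conv map_eq_Cons_conv)
      then have "outcome s x = y"
        using * xy split(2,3) by blast
      then show ?thesis
        unfolding t using outcome_node[OF n perm x _ split(4), of s] G' by simp
    qed
    ultimately show "good_tree n (Suc k) S t"
      by (auto simp: good_tree_def fits_def)
  qed
qed

section \<open>Completeness of the greedy learner\<close>

text \<open>
  Let \<open>a\<close> be the first assignment of \<open>\<tau>\<close> still available.  The remaining examples consistent with
  \<open>a\<close> all take the edge \<open>a\<close> of the given tree, so the greedy choice is never stuck.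
\<close>

lemma greedy_complete:
  assumes n: "0 < n"
    and L: "\<And>S t. sample_on n S \<Longrightarrow> good_tree n k S t \<Longrightarrow> L S \<noteq> None"
    and S: "sample_on n S" and R: "set R \<subseteq> assignments n"
    and off: "\<And>x y a. (x, y) \<in> set S \<Longrightarrow> a \<in> assignments n - set R \<Longrightarrow> \<not> consistent a x"
    and t: "good_tree n (Suc k) S (Node \<tau> es)"
  shows "greedy L (length R) S R \<noteq> None"
  using S R off t
proof (induction "length R" arbitrary: R S)
  case (Suc m)
  have wf: "wf_dtree n (Node \<tau> es)" and dep: "depth (Node \<tau> es) \<le> Suc k"
    and fits: "fits (outcome (Node \<tau> es)) S"
    using Suc.prems(4) by (simp_all only: good_tree_def)
  then have \<tau>: "is_permutation n \<tau>"
    by simp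
  have "\<exists>a \<in> set \<tau>. a \<in> set R"
    using Suc.hyps(2) Suc.prems(2) \<tau> by (cases R) (auto simp: is_permutation_def)
  then obtain ps a qs where split: "\<tau> = ps @ a # qs" "a \<in> set R" "\<forall>b \<in> set ps. b \<notin> set R"
    using split_list_first_prop[of \<tau> "\<lambda>a. a \<in> set R"] by metis
  have query: "aquery \<tau> x = a" if "(x, y) \<in> set S" "consistent a x" for x y
  proof -
    have "set ps \<subseteq> assignments n"
      using \<tau> split(1) by (auto simp: is_permutation_def)
    then have "\<forall>b \<in> set ps. \<not> consistent b x"
      using split(3) Suc.prems(3)[OF that(1)] by blast
    then show ?thesis
      unfolding split(1) using that(2) by (rule aquery_append)
  qed
  have "\<exists>s. good_tree n k (restrict_to a S) s"
  \<comment> \<open>Without an example for \<open>a\<close> the given tree may lack an edge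
    \<open>a\<close>, and a leaf serves instead. Otherwise an example shows that \<open>a\<close>
    lies in the image of the query.\<close>
  proof (cases "restrict_to a S")
    case Nil
    then show ?thesis
      by (intro exI[of _ "Leaf True"]) (simp add: good_tree_def fits_def)
  next
    case (Cons p S')
    then have "p \<in> set (restrict_to a S)" by simp
    then have p: "(fst p, snd p) \<in> set S" "consistent a (fst p)"
      by (auto simp: restrict_to_def)
    have "fst p \<in> words n"
      using p(1) Suc.prems(1) by (auto simp: sample_on_def)
    then have "a \<in> aquery \<tau> ` words n"
      using query[OF p] by blast
    then have "a \<in> fst ` set es"
      using wf by simp
    then obtain s where s: "(a, s) \<in> set es"
      by (metis imageE prod.collapse)
    then have ms: "map_of es a = Some s"
      using wf by simp
    have "outcome s x = y" if "(x, y) \<in> set (restrict_to a S)" for x y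
    proof -
      have xy: "(x, y) \<in> set S" "consistent a x"
        using that by (auto simp: restrict_to_def)
      then have "outcome (Node \<tau> es) x = outcome s x"
        using query ms by (intro outcome_Node) simp
      then show ?thesis
        using fits xy(1) by (auto simp: fits_def)
    qed
    then show ?thesis
      using s wf dep depth_child[OF s, of \<tau>]
      by (intro exI[of _ s]) (auto simp: good_tree_def fits_def simp del: depth.simps)
  qed
  then have "L (restrict_to a S) \<noteq> None"
    using L sample_on_restrict(1)[OF Suc.prems(1)] by blast
  then have "select L S R \<noteq> None"
    using split(2) by (auto simp: select_None)
  then obtain b s R' where sel: "select L S R = Some ((b, s), R')"
    by auto
  from select_Some[OF sel] obtain us vs where R': "R = us @ b # vs" "R' = us @ vs"
    by blast
  have m: "m = length R'"
    using R' Suc.hyps(2) by simp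
  have "greedy L (length R') (restrict_off b S) R' \<noteq> None"
  proof (rule Suc.hyps(1)[OF m])
    show "sample_on n (restrict_off b S)"
      using Suc.prems(1) by simp
    show "set R' \<subseteq> assignments n"
      using R' Suc.prems(2) by auto
    show "\<not> consistent a x" if "(x, y) \<in> set (restrict_off b S)" "a \<in> assignments n - set R'"
      for x y a
    proof (cases "a = b")
      case True
      then show ?thesis using that by (auto simp: restrict_off_def)
    next
      case False
      then show ?thesis
        using that R' Suc.prems(3)[of x y a] by (auto simp: restrict_off_def)
    qed
    show "good_tree n (Suc k) (restrict_off b S) (Node \<tau> es)"
      using wf dep fits by (auto simp: good_tree_def fits_def restrict_off_def
          simp del: wf_dtree.simps depth.simps outcome.simps)
  qed
  then show ?case
    using sel by (simp add: Suc.hyps(2)[symmetric] m)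
qed simp

lemma leaf_or_complete:
  assumes "r \<noteq> None"
  shows "leaf_or r S \<noteq> None"
  using assms by (simp add: leaf_or_def)

lemma leaf_or_complete_Leaf:
  assumes "good_tree n k S (Leaf b)"
  shows "leaf_or r S \<noteq> None"
  using assms by (cases b) (auto simp: leaf_or_def labelled_def good_tree_def fits_def)

lemma learn_complete:
  assumes "is_permutation n A" "sample_on n S" "good_tree n k S t"
  shows "learn n A k S \<noteq> None"
  using assms(2,3)
proof (induction k arbitrary: S t)
  case 0
  then show ?case
    by (cases t) (auto simp: good_tree_def[of _ _ _ "Node _ _"] dest: leaf_or_complete_Leaf)
next
  case (Suc k)
  show ?case
  proof (cases t)
    case (Leaf b)
    then show ?thesis
      using Suc.prems(2) leaf_or_complete_Leaf unfolding learn.simps by blast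
  next
    case (Node \<tau> es)
    have n: "0 < n"
      using Suc.prems(2) Node by (simp add: good_tree_def)
    have "greedy (learn n A k) (length A) S A \<noteq> None"
      using assms(1) Suc.IH Suc.prems Node
      by (intro greedy_complete[OF n]) (auto simp: is_permutation_def)
    then show ?thesis
      unfolding learn.simps using n by (intro leaf_or_complete) simp
  qed
qed

text \<open>The answer is specified by functions, the learner by trees. For \<open>Some t\<close>
  the function is \<open>outcome t\<close>; for \<open>None\<close>, \<open>rk_le_iff\<close> turns
  a hypothetical function into a tree that contradicts completeness.\<close>

lemma learn_correct:
  fixes S :: "'a::finite sample"
  assumes "is_permutation n A" "(n, S) \<in> instances"
  shows "correct_answer k (n, S) (learn n A k S)"
proof -
  have S: "sample_on n S"
    using assms(2) by (auto simp: instances_def sample_on_def)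
  show ?thesis
  proof (cases "learn n A k S")
    case None
    have "\<not> fits h S" if h: "rk n h \<le> k" for h
    proof
      assume f: "fits h S"
      obtain t where t: "computes n t h" "depth t \<le> k"
        using h rk_le_iff by blast
      then have "good_tree n k S t"
        using f S by (force simp: computes_def good_tree_def fits_def sample_on_def)
      then show False
        using learn_complete[OF assms(1) S] None by blast
    qed
    then show ?thesis
      using None by (auto simp: correct_answer_def hyp_class_def)
  next
    case (Some t)
    then have t: "good_tree n k S t"
      using learn_sound[OF assms(1) S] by blast
    then have c: "computes n t (outcome t)" "depth t \<le> k"
      by (simp_all add: good_tree_def computes_def)
    then have "outcome t \<in> hyp_class k n"
      unfolding hyp_class_def using rk_le_iff by blast
    then show ?thesis
      using Some t c by (auto simp: correct_answer_def represents_def good_tree_def)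
  qed
qed


section \<open>Weakest preconditions for the machine model\<close>

text \<open>Total correctness with the exact step count. With the equations below, the simplifier
  executes a program body symbolically and accumulates its running time.\<close>

definition wp :: "program \<Rightarrow> data list \<Rightarrow> expr \<Rightarrow> (data \<Rightarrow> nat \<Rightarrow> bool) \<Rightarrow> bool" where
  "wp P \<rho> e Q \<longleftrightarrow> (\<exists>v t. eval P \<rho> e v t \<and> Q v t)"

definition wps :: "program \<Rightarrow> data list \<Rightarrow> expr list \<Rightarrow> (data list \<Rightarrow> nat \<Rightarrow> bool) \<Rightarrow> bool" where
  "wps P \<rho> es Q \<longleftrightarrow> (\<exists>vs t. evals P \<rho> es vs t \<and> Q vs t)"

lemma wp_EVar: "wp P \<rho> (EVar i) Q \<longleftrightarrow> i < length \<rho> \<and> Q (\<rho> ! i) 1"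
  unfolding wp_def by (subst eval.simps) auto

lemma wp_ENull: "wp P \<rho> ENull Q \<longleftrightarrow> Q Null 1"
  unfolding wp_def by (subst eval.simps) auto

lemma wp_ECell: "wp P \<rho> (ECell e1 e2) Q \<longleftrightarrow>
    wp P \<rho> e1 (\<lambda>v1 t1. wp P \<rho> e2 (\<lambda>v2 t2. Q (Cell v1 v2) (t1 + t2 + 1)))"
  unfolding wp_def by (subst eval.simps) fastforce

lemma wp_EFst: "wp P \<rho> (EFst e) Q \<longleftrightarrow> wp P \<rho> e (\<lambda>v t. Q (dfst v) (t + 1))"
  unfolding wp_def by (subst eval.simps) auto

lemma wp_ESnd: "wp P \<rho> (ESnd e) Q \<longleftrightarrow> wp P \<rho> e (\<lambda>v t. Q (dsnd v) (t + 1))"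
  unfolding wp_def by (subst eval.simps) auto

lemma wp_EIf: "wp P \<rho> (EIf e e1 e2) Q \<longleftrightarrow>
    wp P \<rho> e (\<lambda>v t. if v = Null then wp P \<rho> e2 (\<lambda>v2 t2. Q v2 (t + t2 + 1))
      else wp P \<rho> e1 (\<lambda>v2 t2. Q v2 (t + t2 + 1)))"
    (is "?L \<longleftrightarrow> ?R")
proof
  assume ?L
  then obtain v t where ev: "eval P \<rho> (EIf e e1 e2) v t" and Q: "Q v t"
    by (auto simp: wp_def)
  from ev show ?R
  proof (rule EIf_elim)
    fix v1 t1 t2
    assume "t = Suc (t1 + t2)" "eval P \<rho> e v1 t1" "v1 \<noteq> Null" "eval P \<rho> e1 v t2"
    then show ?R
      unfolding wp_def using Q by (intro exI[of _ v1] exI[of _ t1]) auto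
  next
    fix t1 t2
    assume "t = Suc (t1 + t2)" "eval P \<rho> e Null t1" "eval P \<rho> e2 v t2"
    then show ?R
      unfolding wp_def using Q by (intro exI[of _ Null] exI[of _ t1]) auto
  qed
next
  assume ?R
  then obtain v1 t1 where ev: "eval P \<rho> e v1 t1" and
    Q: "if v1 = Null then wp P \<rho> e2 (\<lambda>v2 t2. Q v2 (t1 + t2 + 1))
      else wp P \<rho> e1 (\<lambda>v2 t2. Q v2 (t1 + t2 + 1))"
    unfolding wp_def[of _ _ e] by blast
  show ?L
  proof (cases "v1 = Null")
    case True
    then obtain v t2 where "eval P \<rho> e2 v t2" "Q v (t1 + t2 + 1)"
      using Q by (auto simp: wp_def)
    then show ?thesis
      unfolding wp_def using EIf_Null[OF ev True] by blast
  next
    case False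
    then obtain v t2 where "eval P \<rho> e1 v t2" "Q v (t1 + t2 + 1)"
      using Q by (auto simp: wp_def)
    then show ?thesis
      unfolding wp_def using EIf_Cell[OF ev False] by blast
  qed
qed

lemma wp_ELet: "wp P \<rho> (ELet e1 e2) Q \<longleftrightarrow>
    wp P \<rho> e1 (\<lambda>v1 t1. wp P (v1 # \<rho>) e2 (\<lambda>v2 t2. Q v2 (t1 + t2 + 1)))"
  unfolding wp_def by (subst eval.simps) fastforce

lemma wp_ECall: "wp P \<rho> (ECall f es) Q \<longleftrightarrow> f < length P \<and>
    wps P \<rho> es (\<lambda>vs t1. wp P vs (P ! f) (\<lambda>v2 t2. Q v2 (t1 + t2 + 1)))"
  unfolding wp_def wps_def by (subst eval.simps) fastforce

lemma wps_Nil: "wps P \<rho> [] Q \<longleftrightarrow> Q [] 0"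
  unfolding wps_def by (subst evals.simps) auto

lemma wps_Cons: "wps P \<rho> (e # es) Q \<longleftrightarrow>
    wp P \<rho> e (\<lambda>v t1. wps P \<rho> es (\<lambda>vs t2. Q (v # vs) (t1 + t2)))"
  unfolding wp_def wps_def by (subst evals.simps) fastforce

lemmas wp_simps = wp_EVar wp_ENull wp_ECell wp_EFst wp_ESnd wp_EIf wp_ELet wp_ECall wps_Nil wps_Cons

section \<open>Running time as a function of the call\<close>

definition run_time :: "program \<Rightarrow> nat \<Rightarrow> data list \<Rightarrow> nat" where
  "run_time P f vs = (THE t. \<exists>v. eval P vs (P ! f) v t)"

definition runs_in :: "program \<Rightarrow> nat \<Rightarrow> data list \<Rightarrow> data \<Rightarrow> nat \<Rightarrow> bool" where
  "runs_in P f vs v T \<longleftrightarrow> eval P vs (P ! f) v (run_time P f vs) \<and> run_time P f vs \<le> T"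

text \<open>Determinism of evaluation makes the time exhibited by \<open>wp\<close> the unique one,
  as the \<open>THE\<close> in \<open>run_time\<close> requires.\<close>

lemma runs_inI:
  assumes "P ! f = b" "wp P vs b (\<lambda>v' t. v' = v \<and> t \<le> T)"
  shows "runs_in P f vs v T"
proof -
  obtain t where t: "eval P vs (P ! f) v t" "t \<le> T"
    using assms by (auto simp: wp_def)
  then have "run_time P f vs = t"
    unfolding run_time_def by (intro the_equality) (blast dest: eval_deterministic(1))+
  then show ?thesis
    using t by (simp add: runs_in_def)
qed

text \<open>
  Rewriting with this equation replaces a call by its result; as \<^const>\<open>run_time\<close> is a function,
  no existential quantifier over the running time of the call arises.
\<close>

lemma runs_in_wp: "runs_in P f vs v T \<Longrightarrow> wp P vs (P ! f) Q \<longleftrightarrow> Q v (run_time P f vs)"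
  unfolding runs_in_def wp_def by (metis eval_deterministic(1))

lemma runs_in_time: "runs_in P f vs v T \<Longrightarrow> run_time P f vs \<le> T"
  by (simp add: runs_in_def)

lemma runs_in_mono: "runs_in P f vs v T \<Longrightarrow> T \<le> T' \<Longrightarrow> runs_in P f vs v T'"
  by (simp add: runs_in_def)


section \<open>The program\<close>

primrec const_expr :: "nat \<Rightarrow> expr" where
  "const_expr 0 = ENull"
| "const_expr (Suc m) = ECell ENull (const_expr m)"

lemma wp_const: "wp P \<rho> (const_expr m) Q \<longleftrightarrow> Q (enc_nat m) (2 * m + 1)"
  by (induction m arbitrary: Q) (simp_all add: wp_simps)

text \<open>The same enumeration enters the program text (\<open>b_all\<close>) and
  \<open>all_assignments\<close>, so both list the assignments in the same order.\<close>

definition letters :: "'a::finite list" where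
  "letters = (SOME ls. distinct ls \<and> set ls = UNIV)"

lemma letters: "distinct (letters :: 'a::finite list)" "set (letters :: 'a list) = UNIV"
proof -
  have "\<exists>ls. distinct ls \<and> set ls = (UNIV :: 'a set)"
    using finite_distinct_list[of "UNIV :: 'a set"] by auto
  then have "distinct (letters :: 'a list) \<and> set (letters :: 'a list) = UNIV"
    unfolding letters_def by (rule someI_ex)
  then show "distinct (letters :: 'a list)" "set (letters :: 'a list) = UNIV"
    by auto
qed

abbreviation ETrue :: expr where "ETrue \<equiv> ECell ENull ENull"
abbreviation (input) "f_eq \<equiv> Suc 0"
abbreviation (input) "f_nth \<equiv> 2 :: nat"
abbreviation (input) "f_part \<equiv> 3 :: nat"
abbreviation (input) "f_labelled \<equiv> 4 :: nat"
abbreviation (input) "f_all \<equiv> 5 :: nat"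
abbreviation (input) "f_occurs \<equiv> 6 :: nat"
abbreviation (input) "f_covering \<equiv> 7 :: nat"
abbreviation (input) "f_prune \<equiv> 8 :: nat"
abbreviation (input) "f_keys \<equiv> 9 :: nat"
abbreviation (input) "f_select \<equiv> 10 :: nat"
abbreviation (input) "f_greedy \<equiv> 11 :: nat"
abbreviation (input) "f_learn \<equiv> 12 :: nat"

definition b_main :: "nat \<Rightarrow> expr" where
  "b_main k = ECall f_learn
     [const_expr k, EFst (EVar 0), ECall f_all [EFst (EVar 0)], ESnd (EVar 0)]"

definition b_eq :: expr where
  "b_eq = EIf (EVar 0)
     (EIf (EVar 1) (ECall f_eq [ESnd (EVar 0), ESnd (EVar 1)]) ENull)
     (EIf (EVar 1) ENull ETrue)"

text \<open>Positions count from 1, so position 1 is a single cell and the tail of the index decides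
  whether to go on.\<close>

definition b_nth :: expr where
  "b_nth = EIf (ESnd (EVar 1)) (ECall f_nth [ESnd (EVar 0), ESnd (EVar 1)]) (EFst (EVar 0))"

text \<open>Both parts of the sample come from one pass. Inside \<open>ELet\<close> the recursive
  result is variable 0, and the assignment and the sample move up to 1 and 2.\<close>

definition b_part :: expr where
  "b_part = EIf (EVar 1)
     (ELet (ECall f_part [EVar 0, ESnd (EVar 1)])
       (EIf (ECall f_eq [ECall f_nth [EFst (EFst (EVar 2)), EFst (EVar 1)], ESnd (EVar 1)])
         (ECell (ECell (EFst (EVar 2)) (EFst (EVar 0))) (ESnd (EVar 0)))
         (ECell (EFst (EVar 0)) (ECell (EFst (EVar 2)) (ESnd (EVar 0))))))
     (ECell ENull ENull)"

definition b_labelled :: expr where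
  "b_labelled = EIf (EVar 1)
     (EIf (ECall f_eq [EVar 0, ESnd (EFst (EVar 1))])
       (ECall f_labelled [EVar 0, ESnd (EVar 1)]) ENull)
     ETrue"

text \<open>The loop over the fixed alphabet is unrolled into the program text; only the loop over
  positions is a recursion.\<close>

definition b_all :: "('a::finite \<Rightarrow> nat) \<Rightarrow> expr" where
  "b_all c = EIf (EVar 0)
     (foldr (\<lambda>\<sigma>. ECell (ECell (EVar 0) (const_expr (c \<sigma>)))) letters
       (ECall f_all [ESnd (EVar 0)]))
     ENull"

definition b_occurs :: expr where
  "b_occurs = EIf (EVar 1)
     (EIf (ECall f_eq [EFst (EFst (EFst (EVar 1))), EVar 0]) ETrue
       (ECall f_occurs [EVar 0, ESnd (EVar 1)]))
     ENull"

definition b_covering :: expr where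
  "b_covering = EIf (EVar 0)
     (EIf (ECall f_occurs [EVar 0, EVar 1]) (ECall f_covering [ESnd (EVar 0), EVar 1]) ENull)
     ETrue"

definition b_prune :: expr where
  "b_prune = EIf (EVar 1)
     (EIf (ECall f_covering [EVar 0, EVar 1])
       (ECell (EFst (EVar 1)) (ECall f_prune [EVar 0, ESnd (EVar 1)])) ENull)
     ENull"

definition b_keys :: expr where
  "b_keys = EIf (EVar 0) (ECell (EFst (EFst (EVar 0))) (ECall f_keys [ESnd (EVar 0)])) ENull"

text \<open>
  The arguments of the last three functions are the rank \<open>k\<close>, the word length, the list of all
  assignments, the sample and, for the first two of them, the list of available assignments.
\<close>

definition b_select :: expr where
  "b_select = EIf (EVar 4)
     (ELet (ECall f_learn [EVar 0, EVar 1, EVar 2, EFst (ECall f_part [EFst (EVar 4), EVar 3])])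
       (EIf (EVar 0)
         (ECell ENull (ECell (ECell (EFst (EVar 5)) (ESnd (EVar 0))) (ESnd (EVar 5))))
         (ELet (ECall f_select [EVar 1, EVar 2, EVar 3, EVar 4, ESnd (EVar 5)])
           (EIf (EVar 0)
             (ECell ENull (ECell (EFst (ESnd (EVar 0)))
               (ECell (EFst (EVar 6)) (ESnd (ESnd (EVar 0))))))
             ENull))))
     ENull"

text \<open>The round counter of \<open>greedy\<close> equals the length of the available list, so
  the program tests that list for emptiness instead.\<close>

definition b_greedy :: expr where
  "b_greedy = EIf (EVar 4)
     (ELet (ECall f_select [EVar 0, EVar 1, EVar 2, EVar 3, EVar 4])
       (EIf (EVar 0)
         (ELet (ECall f_greedy [EVar 1, EVar 2, EVar 3,
             ESnd (ECall f_part [EFst (EFst (ESnd (EVar 0))), EVar 4]), ESnd (ESnd (EVar 0))])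
           (EIf (EVar 0)
             (ECell ENull (ECell (EFst (ESnd (EVar 1))) (ESnd (EVar 0))))
             ENull))
         ENull))
     ETrue"

definition b_learn :: expr where
  "b_learn = EIf (ECall f_labelled [ETrue, EVar 3]) (ECell ENull (ECell ENull ETrue))
     (EIf (ECall f_labelled [ENull, EVar 3]) (ECell ENull (ECell ENull ENull))
       (EIf (EVar 0)
         (EIf (EVar 1)
           (ELet (ECall f_greedy [ESnd (EVar 0), EVar 1, EVar 2, EVar 3, EVar 2])
             (EIf (EVar 0)
               (ECell ENull (ECell ETrue
                 (ECell (ECall f_keys [ESnd (EVar 0)]) (ECall f_prune [EVar 2, ESnd (EVar 0)]))))
               ENull))
           ENull)
         ENull))"

definition prog :: "('a::finite \<Rightarrow> nat) \<Rightarrow> nat \<Rightarrow> program" where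
  "prog c k = [b_main k, b_eq, b_nth, b_part, b_labelled, b_all c, b_occurs, b_covering, b_prune,
     b_keys, b_select, b_greedy, b_learn]"

lemma length_prog: "length (prog c k) = 13"
  by (simp add: prog_def)

lemma prog_nth:
  "prog c k ! 0 = b_main k" "prog c k ! f_eq = b_eq" "prog c k ! f_nth = b_nth"
  "prog c k ! f_part = b_part" "prog c k ! f_labelled = b_labelled" "prog c k ! f_all = b_all c"
  "prog c k ! f_occurs = b_occurs" "prog c k ! f_covering = b_covering"
  "prog c k ! f_prune = b_prune" "prog c k ! f_keys = b_keys" "prog c k ! f_select = b_select"
  "prog c k ! f_greedy = b_greedy" "prog c k ! f_learn = b_learn"
  by (simp_all add: prog_def)

lemmas exec_simps = wp_simps length_prog

lemma enc_nat_Null [simp]: "enc_nat m = Null \<longleftrightarrow> m = 0"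
  by (cases m) auto

lemma enc_bool_Null [simp]: "enc_bool b = Null \<longleftrightarrow> \<not> b"
  by (simp add: enc_bool_def)

lemma enc_list_Null [simp]: "enc_list vs = Null \<longleftrightarrow> vs = []"
  by (cases vs) auto

text \<open>The comparison stops when either number is used up. The bound is in the second one,
  where callers pass the position sought or the letter code of the assignment.\<close>

lemma runs_eq:
  "runs_in (prog c k) f_eq [enc_nat i, enc_nat j] (enc_bool (i = j)) (10 * (j + 1))"
proof (induction j arbitrary: i)
  case 0
  show ?case
    by (rule runs_inI[OF prog_nth(2)]) (cases i; simp add: b_eq_def exec_simps enc_bool_def)
next
  case (Suc j)
  show ?case
  proof (rule runs_inI[OF prog_nth(2)], cases i)
    case 0
    then show "wp (prog c k) [enc_nat i, enc_nat (Suc j)] b_eq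
      (\<lambda>v' t. v' = enc_bool (i = Suc j) \<and> t \<le> 10 * (Suc j + 1))"
      by (simp add: b_eq_def exec_simps enc_bool_def)
  next
    case i: (Suc i')
    show "wp (prog c k) [enc_nat i, enc_nat (Suc j)] b_eq
      (\<lambda>v' t. v' = enc_bool (i = Suc j) \<and> t \<le> 10 * (Suc j + 1))"
      using runs_in_time[OF Suc.IH[of i']]
      by (simp add: b_eq_def exec_simps i runs_in_wp[OF Suc.IH])
  qed
qed

lemma runs_eq_bool:
  "runs_in (prog c k) f_eq [enc_bool a, enc_bool b] (enc_bool (a = b)) 20"
proof -
  have "enc_bool x = enc_nat (of_bool x)" for x
    by (simp add: enc_bool_def)
  moreover have "of_bool a = (of_bool b :: nat) \<longleftrightarrow> a = b"
    by simp
  ultimately show ?thesis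
    using runs_in_mono[OF runs_eq[of c k "of_bool a" "of_bool b"], of 20] by simp
qed

lemma runs_nth:
  assumes "i < length vs"
  shows "runs_in (prog c k) f_nth [enc_list vs, Cell Null (enc_nat i)] (vs ! i) (10 * (i + 1))"
  using assms
proof (induction i arbitrary: vs)
  case 0
  then show ?case
    by (intro runs_inI[OF prog_nth(3)]) (cases vs; simp add: b_nth_def exec_simps)
next
  case (Suc i)
  then obtain v us where vs: "vs = v # us" "i < length us"
    by (cases vs) auto
  show ?case
    using runs_in_time[OF Suc.IH[OF vs(2)]]
    by (intro runs_inI[OF prog_nth(3)]) (simp add: b_nth_def exec_simps vs runs_in_wp[OF Suc.IH])
qed


section \<open>Running times of the functions of the program\<close>

definition enc_sample :: "('a \<Rightarrow> nat) \<Rightarrow> 'a sample \<Rightarrow> data" where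
  "enc_sample c S = enc_list (map (\<lambda>(x, y). Cell (enc_word c x) (enc_bool y)) S)"

definition enc_assignments :: "('a \<Rightarrow> nat) \<Rightarrow> 'a assignment list \<Rightarrow> data" where
  "enc_assignments c R = enc_list (map (enc_assignment c) R)"

definition enc_edges :: "('a \<Rightarrow> nat) \<Rightarrow> ('a assignment \<times> 'a dtree) list \<Rightarrow> data" where
  "enc_edges c G = enc_list (map (\<lambda>(a, t). Cell (enc_assignment c a) (enc_dtree c t)) G)"

lemma enc_lists_Nil_Cons [simp]:
  "enc_sample c [] = Null"
  "enc_sample c ((x, y) # S) = Cell (Cell (enc_word c x) (enc_bool y)) (enc_sample c S)"
  "enc_assignments c [] = Null"
  "enc_assignments c (a # R) = Cell (enc_assignment c a) (enc_assignments c R)"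
  "enc_edges c [] = Null"
  "enc_edges c ((a, t) # G) =
    Cell (Cell (enc_assignment c a) (enc_dtree c t)) (enc_edges c G)"
  by (simp_all add: enc_sample_def enc_assignments_def enc_edges_def)

lemma enc_bool_simps [simp]: "enc_bool False = Null" "enc_bool True = Cell Null Null"
  by (simp_all add: enc_bool_def)

lemma labelled_Cons: "labelled b ((x, y) # S) \<longleftrightarrow> y = b \<and> labelled b S"
  by (auto simp: labelled_def)

lemma runs_labelled:
  "runs_in (prog c k) f_labelled [enc_bool b, enc_sample c S] (enc_bool (labelled b S))
    (40 * (length S + 1))"
proof (induction S)
  case Nil
  show ?case
    by (rule runs_inI[OF prog_nth(5)]) (simp add: b_labelled_def exec_simps labelled_def)
next
  case (Cons p S)
  obtain x y where p: "p = (x, y)" by fastforce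
  show ?case
    using runs_in_time[OF Cons.IH] runs_in_time[OF runs_eq_bool[of c k b y]]
    by (intro runs_inI[OF prog_nth(5)])
      (cases "y = b"; simp add: b_labelled_def exec_simps p runs_in_wp[OF Cons.IH]
        runs_in_wp[OF runs_eq_bool] labelled_Cons)
qed

primrec all_assignments :: "nat \<Rightarrow> 'a::finite assignment list" where
  "all_assignments 0 = []"
| "all_assignments (Suc i) = map (Pair (Suc i)) letters @ all_assignments i"

lemma set_all_assignments: "set (all_assignments i) = assignments i"
  by (induction i) (auto simp: letters assignments_def)

lemma all_assignments_permutation: "is_permutation n (all_assignments n)"
proof -
  have "distinct (all_assignments n :: 'a assignment list)"
    by (induction n)
      (auto simp: letters distinct_map inj_on_def set_all_assignments assignments_def)
  then show ?thesis
    by (simp add: is_permutation_def set_all_assignments)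
qed

lemma length_all_assignments:
  "length (all_assignments n :: 'a::finite assignment list) = n * card (UNIV :: 'a set)"
proof -
  have "length (letters :: 'a list) = card (UNIV :: 'a set)"
    using letters distinct_card by metis
  then show ?thesis
    by (induction n) simp_all
qed

text \<open>Each letter costs \<open>2 * c \<sigma> + 4\<close> steps:
  \<open>2 * c \<sigma> + 1\<close> for its code, one for the position and two for the
  cells.\<close>

lemma wp_letters:
  assumes "0 < length \<rho>"
  shows "wp P \<rho> (foldr (\<lambda>\<sigma>. ECell (ECell (EVar 0) (const_expr (c \<sigma>)))) ls e) Q \<longleftrightarrow>
    wp P \<rho> e (\<lambda>v t. Q (foldr (\<lambda>\<sigma>. Cell (Cell (\<rho> ! 0) (enc_nat (c \<sigma>)))) ls v)
      ((\<Sum>\<sigma>\<leftarrow>ls. Suc (Suc (Suc (Suc (2 * c \<sigma>))))) + t))"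
  using assms
  by (induction ls arbitrary: Q) (simp_all add: wp_simps wp_const add_ac)

text \<open>The cost \<open>K\<close> of one round is a variable with a lower bound, here and in
  similar lemmas below, so the induction step needs no expansion of polynomials.\<close>

lemma runs_all:
  fixes c :: "'a::finite \<Rightarrow> nat"
  assumes "\<And>\<sigma>. c \<sigma> \<le> X" and K: "card (UNIV :: 'a set) * (2 * X + 4) + 20 \<le> K"
  shows "runs_in (prog c k) f_all [enc_nat i] (enc_assignments c (all_assignments i)) ((i + 1) * K)"
proof (induction i)
  case 0
  show ?case
    using K by (intro runs_inI[OF prog_nth(6)]) (simp add: b_all_def exec_simps)
next
  case (Suc i)
  have "(\<Sum>\<sigma>\<leftarrow>letters. Suc (Suc (Suc (Suc (2 * c \<sigma>))))) \<le> (\<Sum>\<sigma>\<leftarrow>(letters :: 'a list). 2 * X + 4)"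
    using assms(1) by (intro sum_list_mono) (simp add: add_mono)
  also have "\<dots> = card (UNIV :: 'a set) * (2 * X + 4)"
    using length_all_assignments[of 1, where 'a = 'a] by (simp add: sum_list_triv)
  finally have "(\<Sum>\<sigma>\<leftarrow>letters. Suc (Suc (Suc (Suc (2 * c \<sigma>))))) + 20 \<le> K"
    using K by linarith
  moreover have "foldr (\<lambda>\<sigma>. Cell (Cell (enc_nat (Suc i)) (enc_nat (c \<sigma>)))) ls (enc_assignments c R) =
      enc_assignments c (map (Pair (Suc i)) ls @ R)" for ls R
    by (induction ls) (simp_all add: enc_assignment_def)
  ultimately show ?case
    using runs_in_time[OF Suc.IH]
    by (intro runs_inI[OF prog_nth(6)])
      (simp add: b_all_def exec_simps wp_letters runs_in_wp[OF Suc.IH] del: enc_nat.simps,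
       simp add: exec_simps runs_in_wp[OF Suc.IH])
qed

lemma runs_occurs:
  assumes K: "10 * i + 60 \<le> K"
  shows "runs_in (prog c k) f_occurs [enc_nat i, enc_edges c G]
    (enc_bool (i \<in> fst ` set (map fst G))) ((length G + 1) * K)"
proof (induction G)
  case Nil
  show ?case
    using K by (intro runs_inI[OF prog_nth(7)]) (simp add: b_occurs_def exec_simps)
next
  case (Cons p G)
  obtain j \<sigma> t where p: "p = ((j, \<sigma>), t)" by (metis prod.collapse)
  show ?case
    using runs_in_time[OF Cons.IH] runs_in_time[OF runs_eq[of c k j i]] K
    by (intro runs_inI[OF prog_nth(7)])
      (auto simp add: b_occurs_def exec_simps p runs_in_wp[OF Cons.IH] runs_in_wp[OF runs_eq]
        enc_assignment_def)
qed

lemma covering_0 [simp]: "covering 0 B"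
  by (simp add: covering_def)

lemma covering_Suc: "covering (Suc i) B \<longleftrightarrow> Suc i \<in> fst ` B \<and> covering i B"
  unfolding covering_def by (simp add: atLeastAtMostSuc_conv)

lemma runs_covering:
  assumes "i \<le> X" and K: "(length G + 1) * (10 * X + 60) + 40 \<le> K"
  shows "runs_in (prog c k) f_covering [enc_nat i, enc_edges c G]
    (enc_bool (covering i (set (map fst G)))) ((i + 1) * K)"
  using assms(1)
proof (induction i)
  case 0
  show ?case
    using K by (intro runs_inI[OF prog_nth(8)]) (simp add: b_covering_def exec_simps)
next
  case (Suc i)
  then have "10 * Suc i + 60 \<le> 10 * X + 60"
    by simp
  note occ = runs_occurs[OF this, of c k G]
  have IH: "runs_in (prog c k) f_covering [enc_nat i, enc_edges c G]
      (enc_bool (covering i (set (map fst G)))) ((i + 1) * K)"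
    using Suc by simp
  show ?case
    using runs_in_time[OF IH] runs_in_time[OF occ] K
    by (intro runs_inI[OF prog_nth(8)])
      (auto simp add: b_covering_def exec_simps runs_in_wp[OF IH]
        runs_in_wp[OF occ[unfolded enc_nat.simps]] covering_Suc)
qed

lemma runs_prune:
  assumes "n \<le> X" "length G \<le> X" and K: "(X + 1) * ((X + 1) * (10 * X + 60) + 40) + 40 \<le> K"
  shows "runs_in (prog c k) f_prune [enc_nat n, enc_edges c G] (enc_edges c (prune n G))
    ((length G + 1) * K)"
  using assms(2)
proof (induction G)
  case Nil
  show ?case
    using K by (intro runs_inI[OF prog_nth(9)]) (simp add: b_prune_def exec_simps)
next
  case (Cons p G)
  obtain a t where p: "p = (a, t)" by fastforce
  have IH: "runs_in (prog c k) f_prune [enc_nat n, enc_edges c G] (enc_edges c (prune n G))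
    ((length G + 1) * K)"
    using Cons by simp
  have "(length (p # G) + 1) * (10 * X + 60) + 40 \<le> (X + 1) * (10 * X + 60) + 40"
    using Cons.prems by (intro add_mono mult_mono) auto
  note cov = runs_covering[OF assms(1) this, of c k]
  have "(n + 1) * ((X + 1) * (10 * X + 60) + 40) \<le> (X + 1) * ((X + 1) * (10 * X + 60) + 40)"
    using assms(1) by (intro mult_mono) auto
  then have "run_time (prog c k) f_covering [enc_nat n, enc_edges c (p # G)] + 40 \<le> K"
    using runs_in_time[OF cov] K by linarith
  then show ?case
    using runs_in_time[OF IH]
    by (intro runs_inI[OF prog_nth(9)])
      (auto simp add: b_prune_def exec_simps runs_in_wp[OF IH]
        runs_in_wp[OF cov[unfolded p enc_lists_Nil_Cons]] p)
qed

lemma runs_keys: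
  "runs_in (prog c k) f_keys [enc_edges c G] (enc_assignments c (map fst G)) ((length G + 1) * 20)"
proof (induction G)
  case Nil
  show ?case
    by (intro runs_inI[OF prog_nth(10)]) (simp add: b_keys_def exec_simps)
next
  case (Cons p G)
  obtain a t where p: "p = (a, t)" by fastforce
  show ?case
    using runs_in_time[OF Cons.IH]
    by (intro runs_inI[OF prog_nth(10)])
      (simp add: b_keys_def exec_simps p runs_in_wp[OF Cons.IH])
qed

lemma runs_part:
  assumes "inj c" "\<And>\<sigma>. c \<sigma> \<le> X" "n \<le> X" "a \<in> assignments n" "sample_on n S"
    and K: "20 * X + 100 \<le> K"
  shows "runs_in (prog c k) f_part [enc_assignment c a, enc_sample c S]
    (Cell (enc_sample c (restrict_to a S)) (enc_sample c (restrict_off a S))) ((length S + 1) * K)"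
  using assms(5)
proof (induction S)
  case Nil
  show ?case
    using K
    by (intro runs_inI[OF prog_nth(4)])
      (simp add: b_part_def exec_simps restrict_to_def restrict_off_def)
next
  case (Cons p S)
  obtain x y where p: "p = (x, y)" by fastforce
  \<comment> \<open>Positions are at least 1; in the form \<open>Suc i\<close> the position encodes
    as the index that \<open>runs_nth\<close> expects, and \<open>i\<close> is the list
    index.\<close>
  obtain i \<sigma> where a: "a = (Suc i, \<sigma>)" "i < n"
    using assms(4) by (cases a; cases "fst a") (auto simp: assignments_def)
  have IH: "runs_in (prog c k) f_part [enc_assignment c a, enc_sample c S]
    (Cell (enc_sample c (restrict_to a S)) (enc_sample c (restrict_off a S))) ((length S + 1) * K)"
    using Cons by (simp add: sample_on_def)
  have i: "i < length x"
    using Cons.prems a by (simp add: p sample_on_def words_def)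
  then have nth: "runs_in (prog c k) f_nth [enc_word c x, Cell Null (enc_nat i)] (enc_nat (c (x ! i)))
    (10 * (i + 1))"
    using runs_nth[of i "map (\<lambda>\<sigma>. enc_nat (c \<sigma>)) x"] by (simp add: enc_word_def)
  have eq: "runs_in (prog c k) f_eq [enc_nat (c (x ! i)), enc_nat (c \<sigma>)]
      (enc_bool (consistent a x)) (10 * (c \<sigma> + 1))"
    using runs_eq[of c k "c (x ! i)" "c \<sigma>"] assms(1) a by (simp add: consistent_def inj_eq)
  have enc_a: "dfst (enc_assignment c a) = Cell Null (enc_nat i)"
    "dsnd (enc_assignment c a) = enc_nat (c \<sigma>)"
    by (simp_all add: a enc_assignment_def)
  have "10 * (i + 1) + 10 * (c \<sigma> + 1) + 80 \<le> K"
    using K assms(2)[of \<sigma>] a(2) assms(3) by simp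
  then have "run_time (prog c k) f_nth [enc_word c x, Cell Null (enc_nat i)] +
      run_time (prog c k) f_eq [enc_nat (c (x ! i)), enc_nat (c \<sigma>)] + 80 \<le> K"
    using runs_in_time[OF nth] runs_in_time[OF eq] by linarith
  then show ?case
    using runs_in_time[OF IH]
    by (intro runs_inI[OF prog_nth(4)])
      (simp add: b_part_def exec_simps p runs_in_wp[OF IH] enc_a runs_in_wp[OF nth] runs_in_wp[OF eq]
        restrict_to_def restrict_off_def)
qed


section \<open>Time recurrences for the mutually recursive learner\<close>

fun enc_selection :: "('a \<Rightarrow> nat) \<Rightarrow>
    (('a assignment \<times> 'a dtree) \<times> 'a assignment list) option \<Rightarrow> data" where
  "enc_selection c None = Null"
| "enc_selection c (Some ((a, t), R)) = Cell Null
    (Cell (Cell (enc_assignment c a) (enc_dtree c t)) (enc_assignments c R))"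

fun enc_greedy :: "('a \<Rightarrow> nat) \<Rightarrow> ('a assignment \<times> 'a dtree) list option \<Rightarrow> data" where
  "enc_greedy c None = Null"
| "enc_greedy c (Some G) = Cell Null (enc_edges c G)"

lemma enc_dtree_node:
  "enc_dtree c (node n G) = Cell (Cell Null Null)
    (Cell (enc_assignments c (map fst G)) (enc_edges c (prune n G)))"
  by (simp add: node_def enc_assignments_def enc_edges_def)

definition part_time :: "nat \<Rightarrow> nat" where
  "part_time X = (X + 1) * (20 * X + 100)"

definition prune_time :: "nat \<Rightarrow> nat" where
  "prune_time X = (X + 1) * ((X + 1) * ((X + 1) * (10 * X + 60) + 40) + 40)"

definition select_time :: "nat \<Rightarrow> nat \<Rightarrow> nat" where
  "select_time X B = (X + 1) * (B + part_time X + 80)"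

definition greedy_time :: "nat \<Rightarrow> nat \<Rightarrow> nat" where
  "greedy_time X B = (X + 1) * (select_time X B + part_time X + 80)"

text \<open>The leaf tests, the greedy rounds, the pruning and the copying of the keys are paid for
  separately. Through \<open>greedy_time\<close> each level multiplies the bound of the level below
  by \<open>(X + 1) * (X + 1)\<close>.\<close>

primrec learn_time :: "nat \<Rightarrow> nat \<Rightarrow> nat" where
  "learn_time X 0 = 80 * (X + 1) + 40"
| "learn_time X (Suc k) =
    80 * (X + 1) + greedy_time X (learn_time X k) + prune_time X + 20 * (X + 1) + 80"

context
  fixes c :: "'a::finite \<Rightarrow> nat" and n X k :: nat
  assumes inj: "inj c" and c_le: "\<And>\<sigma>. c \<sigma> \<le> X" and n_le: "n \<le> X"
begin

lemma runs_part':
  assumes "a \<in> assignments n" "sample_on n S" "length S \<le> X"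
  shows "runs_in (prog c k) f_part [enc_assignment c a, enc_sample c S]
    (Cell (enc_sample c (restrict_to a S)) (enc_sample c (restrict_off a S))) (part_time X)"
proof (rule runs_in_mono)
  show "(length S + 1) * (20 * X + 100) \<le> part_time X"
    unfolding part_time_def using assms(3) by (intro mult_mono) auto
qed (use runs_part[OF inj c_le n_le assms(1,2)] in simp)

text \<open>The hypothesis \<open>L\<close> breaks the mutual recursion: \<open>f_learn\<close> is
  assumed to meet the bound \<open>B\<close> one level down on all samples up to length
  \<open>X\<close>. Restricting never lengthens a sample, so every call stays in that range.\<close>

lemma runs_select:
  assumes L: "\<And>S. sample_on n S \<Longrightarrow> length S \<le> X \<Longrightarrow>
      runs_in (prog c k) f_learn [K, N, A, enc_sample c S] (enc_answer c (L S)) B"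
    and S: "sample_on n S" "length S \<le> X" and "set R \<subseteq> assignments n"
  shows "runs_in (prog c k) f_select [K, N, A, enc_sample c S, enc_assignments c R]
    (enc_selection c (select L S R)) ((length R + 1) * (B + part_time X + 80))"
  using assms(4)
proof (induction R)
  case Nil
  show ?case
    by (intro runs_inI[OF prog_nth(11)]) (simp add: b_select_def exec_simps)
next
  case (Cons a R)
  have IH: "runs_in (prog c k) f_select [K, N, A, enc_sample c S, enc_assignments c R]
      (enc_selection c (select L S R)) ((length R + 1) * (B + part_time X + 80))"
    using Cons by simp
  have part: "runs_in (prog c k) f_part [enc_assignment c a, enc_sample c S]
      (Cell (enc_sample c (restrict_to a S)) (enc_sample c (restrict_off a S))) (part_time X)"
    using Cons.prems S by (intro runs_part') simp_all
  have learn: "runs_in (prog c k) f_learn [K, N, A, enc_sample c (restrict_to a S)]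
      (enc_answer c (L (restrict_to a S))) B"
    using S length_restrict(1)[of a S] by (intro L) simp_all
  define T where "T = B + part_time X + 80"
  have T: "run_time (prog c k) f_part [enc_assignment c a, enc_sample c S] +
      run_time (prog c k) f_learn [K, N, A, enc_sample c (restrict_to a S)] + 80 \<le> T"
    using runs_in_time[OF part] runs_in_time[OF learn] by (simp add: T_def)
  have IH_time: "run_time (prog c k) f_select [K, N, A, enc_sample c S, enc_assignments c R]
      \<le> (length R + 1) * T"
    using runs_in_time[OF IH] by (simp only: T_def)
  show ?case
    unfolding T_def[symmetric]
  proof (rule runs_inI[OF prog_nth(11)], cases "L (restrict_to a S)")
    case (Some t)
    then show "wp (prog c k) [K, N, A, enc_sample c S, enc_assignments c (a # R)] b_select
        (\<lambda>v' t. v' = enc_selection c (select L S (a # R)) \<and> t \<le> (length (a # R) + 1) * T)"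
      using T by (simp add: b_select_def exec_simps runs_in_wp[OF part] runs_in_wp[OF learn])
  next
    case None
    show "wp (prog c k) [K, N, A, enc_sample c S, enc_assignments c (a # R)] b_select
        (\<lambda>v' t. v' = enc_selection c (select L S (a # R)) \<and> t \<le> (length (a # R) + 1) * T)"
    proof (cases "select L S R")
      case None': None
      then show ?thesis
        using T IH_time None
        by (simp add: b_select_def exec_simps runs_in_wp[OF part] runs_in_wp[OF learn]
            runs_in_wp[OF IH])
    next
      case (Some p)
      obtain b t R' where "p = ((b, t), R')" by (metis prod.collapse)
      then show ?thesis
        using T IH_time None Some
        by (simp add: b_select_def exec_simps runs_in_wp[OF part] runs_in_wp[OF learn]
            runs_in_wp[OF IH])
    qed
  qed
qed

lemma runs_greedy:
  assumes L: "\<And>S. sample_on n S \<Longrightarrow> length S \<le> X \<Longrightarrow>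
      runs_in (prog c k) f_learn [K, N, A, enc_sample c S] (enc_answer c (L S)) B"
    and "sample_on n S" "length S \<le> X" "set R \<subseteq> assignments n" "length R \<le> X"
  shows "runs_in (prog c k) f_greedy [K, N, A, enc_sample c S, enc_assignments c R]
    (enc_greedy c (greedy L (length R) S R)) ((length R + 1) * (select_time X B + part_time X + 80))"
  using assms(2-5)
proof (induction "length R" arbitrary: R S)
  case 0
  then show ?case
    by (intro runs_inI[OF prog_nth(12)]) (simp add: b_greedy_def exec_simps)
next
  case (Suc m)
  have R: "enc_assignments c R \<noteq> Null"
    using Suc.hyps(2) by (auto simp: enc_assignments_def)
  define T where "T = select_time X B + part_time X + 80"
  have "(length R + 1) * (B + part_time X + 80) \<le> select_time X B"
    unfolding select_time_def using Suc.prems(4) by (intro mult_mono) auto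
  then have sel: "runs_in (prog c k) f_select [K, N, A, enc_sample c S, enc_assignments c R]
      (enc_selection c (select L S R)) (select_time X B)"
    using runs_in_mono[OF runs_select[OF L Suc.prems(1-3)]] by blast
  show ?case
    unfolding T_def[symmetric]
  proof (rule runs_inI[OF prog_nth(12)], cases "select L S R")
    case None
    moreover have "run_time (prog c k) f_select [K, N, A, enc_sample c S, enc_assignments c R] + 80
        \<le> T"
      using runs_in_time[OF sel] by (simp add: T_def)
    ultimately show "wp (prog c k) [K, N, A, enc_sample c S, enc_assignments c R] b_greedy
        (\<lambda>v' t. v' = enc_greedy c (greedy L (length R) S R) \<and> t \<le> (length R + 1) * T)"
      using R by (simp add: b_greedy_def exec_simps runs_in_wp[OF sel] Suc.hyps(2)[symmetric])
  next
    case (Some p)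
    obtain a t R' where p: "p = ((a, t), R')" by (metis prod.collapse)
    from select_Some[OF Some[unfolded p]] obtain us vs where R': "R = us @ a # vs" "R' = us @ vs"
      by blast
    have m: "m = length R'"
      using R' Suc.hyps(2) by simp
    have part: "runs_in (prog c k) f_part [enc_assignment c a, enc_sample c S]
        (Cell (enc_sample c (restrict_to a S)) (enc_sample c (restrict_off a S))) (part_time X)"
      using R' Suc.prems by (intro runs_part') simp_all
    have IH: "runs_in (prog c k) f_greedy
        [K, N, A, enc_sample c (restrict_off a S), enc_assignments c R']
        (enc_greedy c (greedy L m (restrict_off a S) R')) ((m + 1) * T)"
      unfolding T_def m using Suc.prems R' length_restrict(2)[of a S]
      by (intro Suc.hyps(1)[OF m]) auto
    have "run_time (prog c k) f_select [K, N, A, enc_sample c S, enc_assignments c R] +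
        run_time (prog c k) f_part [enc_assignment c a, enc_sample c S] + 80 \<le> T"
      using runs_in_time[OF sel] runs_in_time[OF part] by (simp add: T_def)
    then show "wp (prog c k) [K, N, A, enc_sample c S, enc_assignments c R] b_greedy
        (\<lambda>v' t. v' = enc_greedy c (greedy L (length R) S R) \<and> t \<le> (length R + 1) * T)"
      using R runs_in_time[OF IH] Some p
      by (cases "greedy L m (restrict_off a S) R'")
        (simp_all add: b_greedy_def exec_simps runs_in_wp[OF sel] runs_in_wp[OF part]
          runs_in_wp[OF IH] Suc.hyps(2)[symmetric])
  qed
qed

lemma runs_learn:
  assumes A: "is_permutation n A" "length A \<le> X" and "sample_on n S" "length S \<le> X"
  shows "runs_in (prog c k) f_learn [enc_nat r, enc_nat n, enc_assignments c A, enc_sample c S]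
    (enc_answer c (learn n A r S)) (learn_time X r)"
  using assms(3,4)
proof (induction r arbitrary: S)
  case 0
  note lab = runs_labelled[of c k _ S]
  note labs = lab[of True, unfolded enc_bool_simps] lab[of False, unfolded enc_bool_simps]
  show ?case
    using runs_in_time[OF labs(1)] runs_in_time[OF labs(2)] \<open>length S \<le> X\<close>
    by (intro runs_inI[OF prog_nth(13)])
      (simp add: b_learn_def exec_simps runs_in_wp[OF labs(1)] runs_in_wp[OF labs(2)] leaf_or_def)
next
  case (Suc r)
  note lab = runs_labelled[of c k _ S]
  note labs = lab[of True, unfolded enc_bool_simps] lab[of False, unfolded enc_bool_simps]
  have "(length A + 1) * (select_time X (learn_time X r) + part_time X + 80)
      \<le> greedy_time X (learn_time X r)"
    unfolding greedy_time_def using A by (intro mult_mono) auto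
  then have greedy: "runs_in (prog c k) f_greedy
      [enc_nat r, enc_nat n, enc_assignments c A, enc_sample c S, enc_assignments c A]
      (enc_greedy c (greedy (learn n A r) (length A) S A)) (greedy_time X (learn_time X r))"
    using A Suc.prems
    by (intro runs_in_mono[OF runs_greedy[OF Suc.IH]]) (simp_all add: is_permutation_def)
  show ?case
  proof (rule runs_inI[OF prog_nth(13)], cases "greedy (learn n A r) (length A) S A")
    case None
    then show "wp (prog c k) [enc_nat (Suc r), enc_nat n, enc_assignments c A, enc_sample c S]
        b_learn (\<lambda>v' t. v' = enc_answer c (learn n A (Suc r) S) \<and> t \<le> learn_time X (Suc r))"
      using runs_in_time[OF labs(1)] runs_in_time[OF labs(2)] \<open>length S \<le> X\<close>
        runs_in_time[OF greedy]
      by (simp add: b_learn_def exec_simps runs_in_wp[OF labs(1)] runs_in_wp[OF labs(2)]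
          leaf_or_def runs_in_wp[OF greedy])
  next
    case (Some G)
    \<comment> \<open>Soundness enters the time analysis here: the keys of \<open>G\<close> are
      those of \<open>A\<close> without repetition, so \<open>G\<close> is short enough for
      \<open>runs_prune\<close>.\<close>
    have "set (map fst G) = set A" "distinct (map fst G)"
      using greedy_sound[OF learn_sound[OF A(1)] Suc.prems(1) Some] A(1)
      by (simp_all add: is_permutation_def)
    then have "length G = length A"
      using A(1) distinct_card unfolding is_permutation_def by (metis length_map)
    then have G: "length G \<le> X"
      using A(2) by simp
    note keys = runs_keys[of c k G]
    have "(length G + 1) * ((X + 1) * ((X + 1) * (10 * X + 60) + 40) + 40) \<le> prune_time X"
      unfolding prune_time_def using G by (intro mult_mono) auto
    then have prune: "runs_in (prog c k) f_prune [enc_nat n, enc_edges c G]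
        (enc_edges c (prune n G)) (prune_time X)"
      using runs_in_mono[OF runs_prune[OF n_le G order_refl]] by blast
    show "wp (prog c k) [enc_nat (Suc r), enc_nat n, enc_assignments c A, enc_sample c S]
        b_learn (\<lambda>v' t. v' = enc_answer c (learn n A (Suc r) S) \<and> t \<le> learn_time X (Suc r))"
      using runs_in_time[OF labs(1)] runs_in_time[OF labs(2)] \<open>length S \<le> X\<close>
        runs_in_time[OF greedy] Some G runs_in_time[OF keys] runs_in_time[OF prune]
      by (simp add: b_learn_def exec_simps runs_in_wp[OF labs(1)] runs_in_wp[OF labs(2)]
          leaf_or_def runs_in_wp[OF greedy] runs_in_wp[OF keys] runs_in_wp[OF prune]
          enc_dtree_node)
  qed
qed

end


definition main_time :: "nat \<Rightarrow> nat \<Rightarrow> nat \<Rightarrow> nat" where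
  "main_time q k X = learn_time X k + (X + 1) * (q * (2 * X + 4) + 20) + 2 * k + 20"

lemma runs_main:
  fixes c :: "'a::finite \<Rightarrow> nat" and S :: "'a sample"
  assumes "inj c" and c_le: "\<And>\<sigma>. c \<sigma> \<le> X" and "n \<le> X" "n * card (UNIV :: 'a set) \<le> X"
    "sample_on n S" "length S \<le> X"
  shows "\<exists>t \<le> main_time (card (UNIV :: 'a set)) k X. runs (prog c k) (enc_instance c (n, S))
    (enc_answer c (learn n (all_assignments n) k S)) t"
proof -
  let ?A = "all_assignments n :: 'a assignment list"
  let ?K = "card (UNIV :: 'a set) * (2 * X + 4) + 20"
  have all: "runs_in (prog c k) f_all [enc_nat n] (enc_assignments c ?A) ((n + 1) * ?K)"
    by (rule runs_all[OF c_le]) simp_all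
  have "(n + 1) * ?K \<le> (X + 1) * ?K"
    using assms(3) by (intro mult_mono) auto
  then have all_time: "run_time (prog c k) f_all [enc_nat n] \<le> (X + 1) * ?K"
    using runs_in_time[OF all] by linarith
  have learn: "runs_in (prog c k) f_learn
      [enc_nat k, enc_nat n, enc_assignments c ?A, enc_sample c S]
      (enc_answer c (learn n ?A k S)) (learn_time X k)"
    using assms by (intro runs_learn all_assignments_permutation) (simp_all add: length_all_assignments)
  have inst: "enc_instance c (n, S) = Cell (enc_nat n) (enc_sample c S)"
    by (simp add: enc_instance_def enc_sample_def)
  have "wp (prog c k) [enc_instance c (n, S)] (ECall 0 [EVar 0])
    (\<lambda>v t. v = enc_answer c (learn n ?A k S) \<and> t \<le> main_time (card (UNIV :: 'a set)) k X)"
    using all_time runs_in_time[OF learn]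
    by (simp add: exec_simps prog_nth(1) b_main_def inst wp_const runs_in_wp[OF all]
        runs_in_wp[OF learn] main_time_def)
  then show ?thesis
    by (auto simp: wp_def runs_def)
qed


section \<open>Size of the output\<close>

lemma cells_enc_nat: "cells (enc_nat m) = 2 * m + 1"
  by (induction m) simp_all

lemma cells_enc_list:
  assumes "\<And>v. v \<in> set vs \<Longrightarrow> cells v \<le> K"
  shows "cells (enc_list vs) \<le> 1 + length vs * (K + 1)"
  using assms
proof (induction vs)
  case (Cons v vs)
  have "cells v \<le> K" "cells (enc_list vs) \<le> 1 + length vs * (K + 1)"
    using Cons by simp_all
  then show ?case by simp
qed simp

lemma cells_enc_assignment:
  assumes "c (snd a) \<le> X" "fst a \<le> X"
  shows "cells (enc_assignment c a) \<le> 4 * X + 3"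
  using assms by (cases a) (simp add: enc_assignment_def cells_enc_nat)

text \<open>A leaf has size at most 5. In a node an assignment has size at most
  \<open>4 * X + 3\<close>, each list entry adds one, and there are at most \<open>X\<close> keys
  and \<open>X\<close> edges.\<close>

primrec tree_size :: "nat \<Rightarrow> nat \<Rightarrow> nat" where
  "tree_size X 0 = 5"
| "tree_size X (Suc k) = 11 + X * (4 * X + 4) + X * (4 * X + 5 + tree_size X k)"

lemma cells_enc_dtree:
  fixes c :: "'a::finite \<Rightarrow> nat"
  assumes c: "\<And>\<sigma>. c \<sigma> \<le> X" and n: "n \<le> X" "n * card (UNIV :: 'a set) \<le> X"
    and "wf_dtree n t" "depth t \<le> k"
  shows "cells (enc_dtree c t) \<le> tree_size X k"
  using assms(4,5)
proof (induction k arbitrary: t)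
  case 0
  then show ?case by (cases t) (simp_all add: enc_bool_def)
next
  case (Suc k)
  show ?case
  proof (cases t)
    case (Leaf b)
    then show ?thesis by (simp add: enc_bool_def)
  next
    case (Node \<tau> es)
    have wf: "0 < n" "is_permutation n \<tau>" "distinct (map fst es)"
      "set (map fst es) = aquery \<tau> ` words n" "\<forall>(a, s) \<in> set es. wf_dtree n s"
      using Suc.prems(1) Node by simp_all
    have assignment: "cells (enc_assignment c a) \<le> 4 * X + 3" if "a \<in> assignments n" for a
      using that n c by (intro cells_enc_assignment) (auto simp: assignments_def)
    have card: "card (assignments n :: 'a assignment set) \<le> X"
      using n by (simp add: assignments_def card_cartesian_product)
    have labels: "set (map fst es) \<subseteq> assignments n"
    proof
      fix a assume "a \<in> set (map fst es)"
      then obtain w where "w \<in> words n" "a = aquery \<tau> w"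
        using wf(4) by auto
      then have "a \<in> set \<tau>"
        using aquery_split[OF permutation_consistent[OF wf(1,2)]] by (metis in_set_conv_decomp)
      then show "a \<in> assignments n"
        using wf(2) by (simp add: is_permutation_def)
    qed
    have "length \<tau> = card (assignments n :: 'a assignment set)"
      using wf(2) distinct_card unfolding is_permutation_def by metis
    then have len_\<tau>: "length \<tau> \<le> X"
      using card by simp
    have "length es = card (set (map fst es))"
      using distinct_card[OF wf(3)] by simp
    also have "\<dots> \<le> card (assignments n :: 'a assignment set)"
      by (rule card_mono[OF finite_assignments labels])
    finally have len_es: "length es \<le> X"
      using card by simp
    have "cells (enc_list (map (enc_assignment c) \<tau>)) \<le>
        1 + length (map (enc_assignment c) \<tau>) * (4 * X + 3 + 1)"
      using wf(2) assignment by (intro cells_enc_list) (auto simp: is_permutation_def)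
    also have "\<dots> \<le> 1 + X * (4 * X + 4)"
      using mult_le_mono1[OF len_\<tau>, of "4 * X + 4"] by (simp add: add_ac)
    finally have 1: "cells (enc_list (map (enc_assignment c) \<tau>)) \<le> 1 + X * (4 * X + 4)" .
    let ?e = "\<lambda>(a, s). Cell (enc_assignment c a) (enc_dtree c s)"
    have "cells (enc_list (map ?e es)) \<le>
        1 + length (map ?e es) * (4 * X + 4 + tree_size X k + 1)"
    proof (rule cells_enc_list)
      fix v assume "v \<in> set (map ?e es)"
      then obtain a s where as: "(a, s) \<in> set es" "v = ?e (a, s)"
        by auto
      have "depth s \<le> k"
        using depth_child[OF as(1), of \<tau>] Suc.prems(2) unfolding Node by linarith
      then have "cells (enc_dtree c s) \<le> tree_size X k"
        using Suc.IH[of s] wf(5) as(1) by auto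
      moreover have "a \<in> assignments n"
        using labels as(1) by force
      ultimately show "cells v \<le> 4 * X + 4 + tree_size X k"
        using assignment[of a] as(2) by simp
    qed
    also have "\<dots> \<le> 1 + X * (4 * X + 5 + tree_size X k)"
      using mult_le_mono1[OF len_es, of "4 * X + 5 + tree_size X k"] by (simp add: add_ac)
    finally show ?thesis
      using 1 Node by simp
  qed
qed


section \<open>Polynomial bounds\<close>

definition poly_bounded :: "(nat \<Rightarrow> nat) \<Rightarrow> bool" where
  "poly_bounded f \<longleftrightarrow> (\<exists>C d. \<forall>x. f x \<le> C * (x + 1) ^ d)"

lemma poly_bounded_const: "poly_bounded (\<lambda>x. C)"
  unfolding poly_bounded_def by (intro exI[of _ C] exI[of _ 0]) simp

lemma poly_bounded_id: "poly_bounded (\<lambda>x. x)"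
  unfolding poly_bounded_def by (intro exI[of _ 1]) simp

lemma poly_bounded_add:
  assumes "poly_bounded f" "poly_bounded g"
  shows "poly_bounded (\<lambda>x. f x + g x)"
proof -
  obtain C d C' d' where *: "\<And>x. f x \<le> C * (x + 1) ^ d" "\<And>x. g x \<le> C' * (x + 1) ^ d'"
    using assms unfolding poly_bounded_def by blast
  have "f x + g x \<le> (C + C') * (x + 1) ^ (d + d')" for x
  proof -
    have "C * (x + 1) ^ d \<le> C * (x + 1) ^ (d + d')" "C' * (x + 1) ^ d' \<le> C' * (x + 1) ^ (d + d')"
      by (intro mult_left_mono power_increasing; simp)+
    then show ?thesis
      using *(1)[of x] *(2)[of x] unfolding add_mult_distrib by linarith
  qed
  then show ?thesis
    unfolding poly_bounded_def by blast
qed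

lemma poly_bounded_mult:
  assumes "poly_bounded f" "poly_bounded g"
  shows "poly_bounded (\<lambda>x. f x * g x)"
proof -
  obtain C d C' d' where *: "\<And>x. f x \<le> C * (x + 1) ^ d" "\<And>x. g x \<le> C' * (x + 1) ^ d'"
    using assms unfolding poly_bounded_def by blast
  have "f x * g x \<le> (C * C') * (x + 1) ^ (d + d')" for x
    using mult_mono[OF *(1)[of x] *(2)[of x]] by (simp add: power_add ac_simps)
  then show ?thesis
    unfolding poly_bounded_def by blast
qed

lemmas poly_bounded_intros =
  poly_bounded_const poly_bounded_id poly_bounded_add poly_bounded_mult

lemma poly_bounded_learn_time: "poly_bounded (\<lambda>X. learn_time X k)"
proof (induction k)
  case 0
  show ?case
    unfolding learn_time.simps by (intro poly_bounded_intros)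
next
  case (Suc k)
  show ?case
    unfolding learn_time.simps greedy_time_def select_time_def part_time_def prune_time_def
    by (intro poly_bounded_intros Suc.IH)
qed

lemma poly_bounded_main_time: "poly_bounded (main_time q k)"
  unfolding main_time_def by (intro poly_bounded_intros poly_bounded_learn_time)

lemma poly_bounded_tree_size: "poly_bounded (\<lambda>X. tree_size X k)"
proof (induction k)
  case 0
  show ?case
    unfolding tree_size.simps by (intro poly_bounded_intros)
next
  case (Suc k)
  show ?case
    unfolding tree_size.simps by (intro poly_bounded_intros Suc.IH)
qed

text \<open>Bounds are stated at \<open>X = D * (sz x + 1)\<close>. As
  \<open>X + 1 \<le> (D + 1) * (sz x + 1)\<close>, the factor \<open>(D + 1) ^ d\<close> is absorbed
  by the constant.\<close>

lemma poly_time_solvableI: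
  assumes "poly_bounded T"
    and "\<And>x. x \<in> I \<Longrightarrow> \<exists>y t. runs P (enc_in x) (enc_out y) t \<and> correct x y \<and>
      t \<le> T (D * (sz x + 1)) \<and> cells (enc_out y) \<le> T (D * (sz x + 1))"
  shows "poly_time_solvable I enc_in sz enc_out correct"
proof -
  obtain C d where T: "\<And>X. T X \<le> C * (X + 1) ^ d"
    using assms(1) unfolding poly_bounded_def by blast
  have bound: "T (D * (s + 1)) \<le> C * (D + 1) ^ d * (s + 1) ^ d" for s
  proof -
    have "D * (s + 1) + 1 \<le> (D + 1) * (s + 1)"
      by simp
    then have "C * (D * (s + 1) + 1) ^ d \<le> C * ((D + 1) * (s + 1)) ^ d"
      by (intro mult_left_mono power_mono) simp_all
    also have "\<dots> = C * (D + 1) ^ d * (s + 1) ^ d"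
      by (simp only: power_mult_distrib mult.assoc)
    finally show ?thesis
      using T[of "D * (s + 1)"] by linarith
  qed
  show ?thesis
    unfolding poly_time_solvable_def
  proof (rule exI, rule exI, rule exI, rule ballI)
    fix x assume "x \<in> I"
    from assms(2)[OF this] obtain y t where "runs P (enc_in x) (enc_out y) t" "correct x y"
      "t \<le> T (D * (sz x + 1))" "cells (enc_out y) \<le> T (D * (sz x + 1))"
      by blast
    then show "\<exists>y t. runs P (enc_in x) (enc_out y) t \<and> correct x y \<and>
        t \<le> C * (D + 1) ^ d * (sz x + 1) ^ d \<and>
        cells (enc_out y) \<le> C * (D + 1) ^ d * (sz x + 1) ^ d"
      using bound[of "sz x"] by (meson le_trans)
  qed
qed

theorem theorem4:
  fixes k :: nat and c :: "'a::finite \<Rightarrow> nat"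
  assumes "inj c"
  shows "poly_time_solvable (instances :: (nat \<times> 'a sample) set)
           (enc_instance c) (\<lambda>(n, S). n + length S)
           (enc_answer c) (correct_answer k)"
proof -
  define q where "q = card (UNIV :: 'a set)"
  define M where "M = Max (range c)"
  \<comment> \<open>The summands let \<open>X\<close> dominate all that it must bound:
    \<open>q\<close> for the number \<open>n * q\<close> of assignments, \<open>M\<close> for the
    letter codes, 1 for the word length and the sample length.\<close>
  define D where "D = q + M + 1"
  \<comment> \<open>The sum bounds running time and output size at once; the 2 pays for the outer
    cell of \<open>Some\<close>.\<close>
  define T where "T X = main_time q k X + (tree_size X k + 2)" for X
  have T: "poly_bounded T"
    unfolding T_def
    by (intro poly_bounded_add poly_bounded_main_time poly_bounded_tree_size poly_bounded_const)
  show ?thesis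
  proof (rule poly_time_solvableI[OF T, where P = "prog c k" and D = D])
    fix x :: "nat \<times> 'a sample"
    assume x: "x \<in> instances"
    obtain n S where nS: "x = (n, S)" by fastforce
    have S: "sample_on n S"
      using x nS by (auto simp: instances_def sample_on_def)
    define X where "X = D * (n + length S + 1)"
    have X: "X = (q + M + 1) * n + (q + M + 1) * length S + (q + M + 1)"
      by (simp add: X_def D_def algebra_simps)
    have c_le: "c \<sigma> \<le> X" for \<sigma>
    proof -
      have "c \<sigma> \<le> M"
        unfolding M_def by (intro Max_ge) simp_all
      then show ?thesis
        unfolding X by linarith
    qed
    have le: "n \<le> X" "n * q \<le> X" "length S \<le> X"
      unfolding X by (simp_all add: algebra_simps)
    define r where "r = learn n (all_assignments n) k S"
    obtain t where t: "t \<le> main_time q k X" "runs (prog c k) (enc_instance c x) (enc_answer c r) t"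
      using runs_main[OF assms c_le le(1) _ S le(3), of k] le(2) unfolding q_def r_def nS by blast
    have "correct_answer k x r"
      unfolding r_def nS
      using x nS by (intro learn_correct all_assignments_permutation) simp
    moreover have "cells (enc_answer c r) \<le> tree_size X k + 2"
    proof (cases r)
      case (Some s)
      then have "wf_dtree n s" "depth s \<le> k"
        using learn_sound[OF all_assignments_permutation S] unfolding r_def good_tree_def by blast+
      then show ?thesis
        using Some cells_enc_dtree[OF c_le le(1)] le(2) unfolding q_def by simp
    qed simp
    ultimately show "\<exists>y t. runs (prog c k) (enc_instance c x) (enc_answer c y) t \<and>
        correct_answer k x y \<and>
        t \<le> T (D * ((case x of (n, S) \<Rightarrow> n + length S) + 1)) \<and>
        cells (enc_answer c y) \<le> T (D * ((case x of (n, S) \<Rightarrow> n + length S) + 1))"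
      using t unfolding T_def nS X_def[symmetric] prod.case by (intro exI[of _ r] exI[of _ t]) simp
  qed
qed

end
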